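(* Consider the regression model $Y_i=l(X_i)+\varepsilon_i$, $i=1,\ldots,n$, with independent identically distributed errors having a Lebesgue density $f$ symmetric about $0$. Assume: (i) $X_i=H^{-1}(i/n)$, $i=1,\ldots,n$, where $H$ is the distribution function of a strictly positive and continuous Lebesgue probability density $h$ on $[0,1]$ of finite total variation, and $\sup_{|x-y|\leq \delta} |h(x) - h(y)| = O(1/\log(1/\delta))$ as $\delta \to 0$; (ii) $f$ is strictly positive and absolutely continuous on $\mathbb{R}$ with finite Fisher information $I(f):=\int\left(\frac{f'(x)}{f(x)}\right)^2f(x)\,dx$, and the first derivative of $f$ exists and is uniformly bounded and integrable; (iii) there exists a constant $\delta_0>0$ such that $$\int \left\{ \left(\frac{f(z+\theta)}{f(z)}\right)^{1+\delta} - 1 \right\} f(z)\, dz = \frac{1}{2}\delta(1+\delta)\theta^2 I(f)\,(1 + r(\theta, \delta))$$ with $r(\theta,\delta)=O(1/\log(1/|\theta|))$ as $|\theta|\to0$, uniformly in $\delta\in(0,\delta_0]$. Let $\phi_n$ be the conditional multiscale signed rank test at level $\alpha\in(0,1)$ (defined in the context), based on some positive continuous kernel $\psi$ on $[0,1]$ of bounded total variation with $\int_0^1\psi(x)\,dx=1$. Then for arbitrary $\beta>0$, $L>0$, there exist constants $c(\beta,L,\psi)\ge d^*(\beta,L)$ such that $$\liminf_{n \to \infty}\ \inf_{\substack{l \in \mathcal{H}_h(\beta,L): \\ \|l\sqrt{h}\|_{[0,1]} \geq c(\beta,L,\psi)\rho_n}} \mathbb{P}_l(\phi_n = 1) = 1,$$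 where $\rho_n:=((\log n)/n)^{\beta/(2\beta+1)}$ and $$d^*(\beta,L) := \left( \frac{2L^{1/\beta}}{(2\beta + 1)\,12\left(\int f(y)^2 \, dy\right)^2 \|\gamma_\beta\|_2^2} \right)^{\beta/(2\beta+1)}.$$
   Context: Hölder classes: for an interval $I\subset\mathbb{R}$ and $\beta,L>0$, if $0<\beta\le1$, $\mathcal{H}(\beta,L;I):=\{g:I\to\mathbb{R}\mid |g(x)-g(y)|\le L|x-y|^\beta\ \text{for all }x,y\in I\}$; if $k<\beta\le k+1$ for an integer $k\ge1$, $\mathcal{H}(\beta,L;I)$ is the set of functions on $I$ that are $k$ times differentiable and whose $k$th derivative belongs to $\mathcal{H}(\beta-k,L;I)$. Given the design density $h$, $\mathcal{H}_h(\beta,L):=\{g/\sqrt h\mid g\in\mathcal{H}(\beta,L;[0,1])\}$. $\gamma_\beta$ denotes the solution of the problem of minimizing $\|\gamma\|_2$ over all $\gamma\in\mathcal{H}(\beta,1;\mathbb{R})$ with $\gamma(0)\ge1$; it is known to be an even function with compact support and $\gamma_\beta(0)=1>|\gamma_\beta(x)|$ for $x\neq0$. The norm $\|\cdot\|_2$ is the $L_2$-norm with respect to Lebesgue measure, and $\|g\|_{[0,1]}:=\sup_{x\in[0,1]}|g(x)|$. $\mathbb{P}_l$ denotes probability when the regression function is $l$. The design points are deterministic and depend on $n$. The test $\phi_n$ depends on neither $\beta$ nor $L$; the error density $f$ and the design density $h$ are fixed. Conditional multiscale signed rank test at level $\alpha$ based on a kernel $\psi:[0,1]\to\mathbb{R}$: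 for $0\le s<t\le1$ let $\psi_{st}(x):=\psi\left(\frac{x-s}{t-s}\right)$ for $x\in[s,t]$, and write $\psi_{jk}:=\psi_{X_jX_k}$ for $1\le j<k\le n$. Let $R_{jk}(i)$ be the rank of $|Y_i|$ among the $k-j+1$ numbers $|Y_m|$, $m=j,\ldots,k$. Define $$T_{jk} := \frac{\sum_{i=j}^k \psi_{jk}(X_i) \operatorname{sign}(Y_i) R_{jk}(i)}{\sqrt{\sum_{i=j}^k \psi_{jk}(X_i)^2 R_{jk}(i)^2}}$$ if the denominator is nonzero and $T_{jk}:=0$ otherwise, and $$T_n := \max_{1 \leq j < k \leq n} \left\{|T_{jk}| - \sqrt{2 \log(n/(k-j))}\right\}.$$ Let $R=R_{1n}=(R_{1n}(i))_{i=1}^n$ be the vector of ranks of $|Y_1|,\ldots,|Y_n|$, and let $\kappa_\alpha(R):=\arg\min_{C>0}\{\mathbb{P}(T_n\le C\mid R)\ge1-\alpha\}$ be the generalized $(1-\alpha)$-quantile of the conditional distribution of $T_n$ given $R$ under the null hypothesis $l=0$ (i.e. the smallest such $C$; under the null hypothesis, given $R$, the signs $\operatorname{sign}(Y_i)$ are i.i.d. uniform on $\{-1,1\}$, so this conditional distribution does not depend on the error distribution). The test equals $1$ (rejects $l=0$) if $T_n>\kappa_\alpha(R)$ and $0$ if $T_n\le\kappa_\alpha(R)$. *)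

theory Defs
  imports "HOL-Probability.Probability" "HOL-Library.Landau_Symbols"
begin

definition bounded_variation_on :: "(real \<Rightarrow> real) \<Rightarrow> real set \<Rightarrow> bool" where
  "bounded_variation_on g S \<longleftrightarrow>
     (\<exists>V. \<forall>(m::nat) p. mono_on {..m} p \<and> p ` {..m} \<subseteq> S \<longrightarrow>
        (\<Sum>i<m. \<bar>g (p (Suc i)) - g (p i)\<bar>) \<le> V)"

text \<open>Absolute continuity of a function of a real variable; the library constant
  \<open>absolutely_continuous\<close> concerns measures.\<close>

definition abs_continuous_on :: "(real \<Rightarrow> real) \<Rightarrow> real set \<Rightarrow> bool" where
  "abs_continuous_on g S \<longleftrightarrow>
     (\<forall>e>0. \<exists>d>0. \<forall>(m::nat) a b.
        (\<forall>i<m. a i \<le> b i \<and> {a i..b i} \<subseteq> S) \<and>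
        disjoint_family_on (\<lambda>i. {a i<..<b i}) {..<m} \<and>
        (\<Sum>i<m. b i - a i) < d \<longrightarrow>
        (\<Sum>i<m. \<bar>g (b i) - g (a i)\<bar>) < e)"

definition fisher_information :: "(real \<Rightarrow> real) \<Rightarrow> real" where
  "fisher_information f = (\<integral>x. (deriv f x / f x)\<^sup>2 * f x \<partial>lborel)"

definition sup_norm_on :: "real set \<Rightarrow> (real \<Rightarrow> real) \<Rightarrow> real" where
  "sup_norm_on S g = (SUP x\<in>S. \<bar>g x\<bar>)"

definition lebesgue_L2_norm :: "(real \<Rightarrow> real) \<Rightarrow> real" where
  "lebesgue_L2_norm g = sqrt (\<integral>x. (g x)\<^sup>2 \<partial>lborel)"


text \<open>The index \<open>k\<close> is determined by \<open>\<beta>\<close>, and \<open>k = 0\<close> is the case \<open>0 < \<beta> \<le> 1\<close>.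
  The function \<open>D j\<close> is the \<open>j\<close>-th derivative of \<open>g\<close> on \<open>I\<close>; at an endpoint of \<open>I\<close> the
  derivatives are one-sided. Values outside \<open>I\<close> are unconstrained.\<close>

definition hoelder_class :: "real \<Rightarrow> real \<Rightarrow> real set \<Rightarrow> (real \<Rightarrow> real) set" where
  "hoelder_class \<beta> L I =
     {g. \<exists>(k::nat) D. real k < \<beta> \<and> \<beta> \<le> real k + 1 \<and>
        (\<forall>x\<in>I. D 0 x = g x) \<and>
        (\<forall>j<k. \<forall>x\<in>I. (D j has_real_derivative D (Suc j) x) (at x within I)) \<and>
        (\<forall>x\<in>I. \<forall>y\<in>I. \<bar>D k x - D k y\<bar> \<le> L * \<bar>x - y\<bar> powr (\<beta> - real k))}"

definition weighted_hoelder_class ::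
    "(real \<Rightarrow> real) \<Rightarrow> real \<Rightarrow> real \<Rightarrow> (real \<Rightarrow> real) set" where
  "weighted_hoelder_class h \<beta> L = (\<lambda>g x. g x / sqrt (h x)) ` hoelder_class \<beta> L {0..1}"

text \<open>Square integrability is required explicitly because the Bochner integral of a
  non-integrable function is 0. A minimizer is known to exist, and it is unique by strict
  convexity of the norm and continuity, so that the choice made by \<open>arg_min\<close> is immaterial.\<close>

definition optimal_recovery :: "real \<Rightarrow> (real \<Rightarrow> real)" where
  "optimal_recovery \<beta> =
     arg_min lebesgue_L2_norm
       (\<lambda>g. g \<in> hoelder_class \<beta> 1 UNIV \<and> g 0 \<ge> 1 \<and> integrable lborel (\<lambda>x. (g x)\<^sup>2))"

definition d_star :: "(real \<Rightarrow> real) \<Rightarrow> real \<Rightarrow> real \<Rightarrow> real" where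
  "d_star f \<beta> L =
     (2 * L powr (1 / \<beta>) /
        ((2 * \<beta> + 1) * 12 * (\<integral>y. (f y)\<^sup>2 \<partial>lborel)\<^sup>2 *
          (lebesgue_L2_norm (optimal_recovery \<beta>))\<^sup>2)) powr (\<beta> / (2 * \<beta> + 1))"

definition rate :: "real \<Rightarrow> nat \<Rightarrow> real" where
  "rate \<beta> n = (ln (real n) / real n) powr (\<beta> / (2 * \<beta> + 1))"


definition design_cdf :: "(real \<Rightarrow> real) \<Rightarrow> real \<Rightarrow> real" where
  "design_cdf h = cdf (density lborel (\<lambda>x. ennreal (h x * indicator {0..1} x)))"

definition design :: "(real \<Rightarrow> real) \<Rightarrow> nat \<Rightarrow> nat \<Rightarrow> real" where
  "design h n i = the_inv_into {0..1} (design_cdf h) (real i / real n)"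

text \<open>The joint law of \<open>Y i = l (X i) + e i\<close>, \<open>1 \<le> i \<le> n\<close>, where the errors \<open>e i\<close> are
  independent with density \<open>f\<close>.\<close>

definition regression_law ::
    "(real \<Rightarrow> real) \<Rightarrow> (nat \<Rightarrow> real) \<Rightarrow> nat \<Rightarrow> (real \<Rightarrow> real) \<Rightarrow> (nat \<Rightarrow> real) measure" where
  "regression_law f X n l =
     distr (\<Pi>\<^sub>M i\<in>{1..n}. density lborel (\<lambda>z. ennreal (f z))) (\<Pi>\<^sub>M i\<in>{1..n}. borel)
       (\<lambda>e. \<lambda>i\<in>{1..n}. l (X i) + e i)"


text \<open>For tied absolute values this is the maximal rank; under the error densities
  considered, ties have probability zero.\<close>

definition local_rank :: "(nat \<Rightarrow> real) \<Rightarrow> nat \<Rightarrow> nat \<Rightarrow> nat \<Rightarrow> nat" where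
  "local_rank Y j k i = card {m \<in> {j..k}. \<bar>Y m\<bar> \<le> \<bar>Y i\<bar>}"

definition rank_vector :: "nat \<Rightarrow> (nat \<Rightarrow> real) \<Rightarrow> nat \<Rightarrow> nat" where
  "rank_vector n Y = (\<lambda>i\<in>{1..n}. local_rank Y 1 n i)"

definition rescaled_kernel :: "(real \<Rightarrow> real) \<Rightarrow> real \<Rightarrow> real \<Rightarrow> real \<Rightarrow> real" where
  "rescaled_kernel \<psi> s t x = \<psi> ((x - s) / (t - s))"

definition local_statistic ::
    "(real \<Rightarrow> real) \<Rightarrow> (nat \<Rightarrow> real) \<Rightarrow> (nat \<Rightarrow> real) \<Rightarrow> nat \<Rightarrow> nat \<Rightarrow> real" where
  "local_statistic \<psi> X Y j k =
     (let w = (\<lambda>i. rescaled_kernel \<psi> (X j) (X k) (X i));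
          den = sqrt (\<Sum>i=j..k. (w i)\<^sup>2 * (real (local_rank Y j k i))\<^sup>2)
      in if den \<noteq> 0
         then (\<Sum>i=j..k. w i * sgn (Y i) * real (local_rank Y j k i)) / den
         else 0)"

text \<open>Meaningful for \<open>n \<ge> 2\<close>, where the set of index pairs is nonempty.\<close>

definition multiscale_statistic ::
    "(real \<Rightarrow> real) \<Rightarrow> (nat \<Rightarrow> real) \<Rightarrow> nat \<Rightarrow> (nat \<Rightarrow> real) \<Rightarrow> real" where
  "multiscale_statistic \<psi> X n Y =
     Max ((\<lambda>(j, k). \<bar>local_statistic \<psi> X Y j k\<bar> -
             sqrt (2 * ln (real n / (real k - real j)))) `
          {(j, k). 1 \<le> j \<and> j < k \<and> k \<le> n})"

text \<open>The quantile is conditional on the event that the rank vector equals \<open>r\<close>, under the null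
  law \<open>l = 0\<close>. The infimum is the smallest admissible \<open>C > 0\<close> whenever that exists; it is 0 if
  every \<open>C > 0\<close> is admissible.\<close>

definition conditional_quantile ::
    "(real \<Rightarrow> real) \<Rightarrow> (real \<Rightarrow> real) \<Rightarrow> (nat \<Rightarrow> real) \<Rightarrow> real \<Rightarrow> nat \<Rightarrow> (nat \<Rightarrow> nat) \<Rightarrow> real" where
  "conditional_quantile f \<psi> X \<alpha> n r =
     Inf {C. C > 0 \<and>
       cond_prob (regression_law f X n (\<lambda>_. 0))
         (\<lambda>Y. multiscale_statistic \<psi> X n Y \<le> C) (\<lambda>Y. rank_vector n Y = r) \<ge> 1 - \<alpha>}"

definition signed_rank_test ::
    "(real \<Rightarrow> real) \<Rightarrow> (real \<Rightarrow> real) \<Rightarrow> (nat \<Rightarrow> real) \<Rightarrow> real \<Rightarrow> nat \<Rightarrow> (nat \<Rightarrow> real) \<Rightarrow> nat" where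
  "signed_rank_test f \<psi> X \<alpha> n Y =
     (if multiscale_statistic \<psi> X n Y > conditional_quantile f \<psi> X \<alpha> n (rank_vector n Y)
      then 1 else 0)"

end

theory Submission
  imports Defs "HOL-Real_Asymp.Real_Asymp"
begin

text \<open>The existential constant may be any large number, so the theorem is a statement about the rate
\<open>\<rho> = (ln n / n) powr (\<beta> / (2 * \<beta> + 1))\<close>: crude bounds of the right order of magnitude suffice.

The critical value is at most \<open>sqrt (6 * ln n)\<close>. Given the absolute values of the errors, each
local statistic is under the null hypothesis a normalised sum of weighted independent random
signs, so it has a subgaussian tail (\<open>rademacher_tail\<close>), and a union bound over the at most
\<open>n\<^sup>2\<close> index pairs leaves a conditional exceedance probability \<open>2 / n\<close> (\<open>quantile_le\<close>). The additive
correction \<open>sqrt (2 * ln (n / (k - j)))\<close> is of the same order, at most \<open>sqrt (2 * ln n)\<close>.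
Hence the test rejects as soon as one local statistic exceeds \<open>4 * sqrt (ln n)\<close>.

Such a statistic exists under the alternative. Put \<open>\<delta> = (ln n / n) powr (1 / (2 * \<beta> + 1))\<close>, so
that \<open>\<rho> = \<delta> powr \<beta>\<close>. If \<open>g\<close> is in the Hoelder class and its sup norm is at least
\<open>c * \<delta> powr \<beta>\<close>, then \<open>g\<close> keeps its sign and half of its maximal absolute value on an interval
of length a constant times \<open>\<delta>\<close> (\<open>hoelder_plateau\<close>, from bounds on intermediate derivatives). The
interval contains \<open>N\<close> design points, with \<open>N\<close> at least a constant times \<open>n * \<delta>\<close>
(\<open>many_design_points\<close>), and there the regression function is of constant sign and at least
\<open>\<tau>\<close>, a constant times \<open>c * \<rho>\<close>. Therefore \<open>N * \<tau>\<^sup>2\<close> is at least a constant times \<open>c\<^sup>2 * ln n\<close>.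

The numerator of the local statistic is a weighted sum, over pairs \<open>(i, m)\<close>, of the sign of
\<open>Y i\<close> when \<open>Y i\<close> is the observation of larger absolute value. For two distinct observations the
two ordered terms add up to the sign of \<open>Y i + Y m\<close>, whose mean is of order \<open>\<tau>\<close>
(\<open>signed_win_pair_mean\<close>); each single term has a mean of the right sign
(\<open>signed_win_mean_nonneg\<close>), so that positive weights can be bounded from below. The mean of the
numerator is thus of order \<open>N\<^sup>2 * \<tau>\<close>. Terms with disjoint index pairs are
uncorrelated, which makes the variance of order \<open>N ^ 3\<close> (\<open>pair_sum_variance\<close>), and by
Chebyshev's inequality the numerator is at least half of the lower bound for its mean up to a
probability of order \<open>1 / (N * \<tau>\<^sup>2)\<close>, that is \<open>1 / ln n\<close>, uniformly over the alternatives
(\<open>rank_sum_large\<close>). Since the denominator is at most of order \<open>N powr (3 / 2)\<close>, the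
statistic is then of order \<open>sqrt N * \<tau>\<close>, which exceeds \<open>4 * sqrt (ln n)\<close> for large \<open>c\<close>.\<close>

section \<open>Plateaus of Hoelder functions\<close>

text \<open>The growth constants of the trisection argument below: passing from the \<open>j\<close>-th to the next
derivative costs a factor \<open>2\<close> for the difference of two values, a factor \<open>3\<close> for their distance, and a
factor \<open>3 ^ j\<close> because the \<open>j\<close>-th derivative is controlled on an interval of a third of the length.\<close>

definition trisection_const :: "nat \<Rightarrow> real" where
  "trisection_const j = (\<Prod>i<j. 6 * 3 ^ i)"

lemma trisection_const_ge_1: "trisection_const j \<ge> 1"
  unfolding trisection_const_def by (rule prod_ge_1) (use one_le_power[of "3::real"] in \<open>auto intro: order_trans[of 1 "6*1"]\<close>)

text \<open>Both the left and the right third of the interval contain a point at which the \<open>j\<close>-th derivative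
is small, and these points are at least a third of the length apart; the mean value theorem between
them yields a point with a small next derivative.\<close>

lemma small_derivative_somewhere:
  fixes D :: "nat \<Rightarrow> real \<Rightarrow> real"
  assumes "a < b"
    and "\<And>i x. i < k \<Longrightarrow> x \<in> {a..b} \<Longrightarrow> (D i has_real_derivative D (Suc i) x) (at x within {a..b})"
    and "\<And>x. x \<in> {a..b} \<Longrightarrow> \<bar>D 0 x\<bar> \<le> M" and "j \<le> k"
  shows "\<exists>x\<in>{a..b}. \<bar>D j x\<bar> \<le> trisection_const j * M / (b - a) ^ j"
  using assms
proof (induction j arbitrary: a b)
  case 0
  then show ?case by (intro bexI[of _ a]) (auto simp: trisection_const_def)
next
  case (Suc j)
  define d where "d = (b - a) / 3"
  have d: "d > 0" "b = a + 3 * d" using Suc.prems(1) by (auto simp: d_def field_simps)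
  \<comment> \<open>the induction hypothesis on an arbitrary subinterval of a third of the length\<close>
  have *: "\<exists>x\<in>{a'..a' + d}. \<bar>D j x\<bar> \<le> trisection_const j * M / d ^ j" if "a \<le> a'" "a' + d \<le> b" for a'
  proof -
    have sub: "{a'..a'+d} \<subseteq> {a..b}" using that by auto
    have "\<exists>x\<in>{a'..a' + d}. \<bar>D j x\<bar> \<le> trisection_const j * M / (a' + d - a') ^ j"
      using d Suc.prems sub
      by (intro Suc.IH) (auto intro!: DERIV_subset[OF Suc.prems(2) sub])
    then show ?thesis by simp
  qed
  obtain x where x: "x \<in> {a..a+d}" "\<bar>D j x\<bar> \<le> trisection_const j * M / d ^ j"
    using *[of a] d by auto
  obtain y where y: "y \<in> {a+2*d..a+2*d+d}" "\<bar>D j y\<bar> \<le> trisection_const j * M / d ^ j"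
    using *[of "a+2*d"] d by auto
  have xy: "x < y" "y - x \<ge> d" "{x..y} \<subseteq> {a..b}" using x y d by auto
  have "\<exists>z\<in>{x..y}. D j y - D j x = D (Suc j) z * (y - x)"
    using xy Suc.prems
    by (intro mvt_very_simple[of x y "D j" "\<lambda>z h. D (Suc j) z * h"])
       (auto simp: has_field_derivative_def intro!: has_derivative_subset[OF _ xy(3)])
  then obtain z where z: "z \<in> {x..y}" "D j y - D j x = D (Suc j) z * (y - x)" by blast
  have "d * \<bar>D (Suc j) z\<bar> \<le> \<bar>D (Suc j) z\<bar> * (y - x)" using xy d by (auto intro: mult_right_mono simp: mult.commute)
  also have "\<dots> = \<bar>D j y - D j x\<bar>" using z xy by (simp add: abs_mult)
  also have "\<dots> \<le> 2 * (trisection_const j * M / d ^ j)" using x(2) y(2) by linarith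
  finally have "\<bar>D (Suc j) z\<bar> \<le> 2 * (trisection_const j * M / d ^ j) / d"
    using d by (simp add: field_simps)
  also have "\<dots> = trisection_const (Suc j) * M / (b - a) ^ Suc j"
    using d by (simp add: trisection_const_def power_mult_distrib field_simps)
  finally show ?case using z xy by auto
qed

text \<open>A Landau--Kolmogorov type inequality. The top derivative is small somewhere and oscillates by at
most \<open>W\<close>, hence is bounded; descending from \<open>k\<close>, each derivative is small somewhere and its slope
is already bounded.\<close>

lemma intermediate_derivative_bound:
  fixes D :: "nat \<Rightarrow> real \<Rightarrow> real"
  assumes ab: "a < b"
    and der: "\<And>i x. i < k \<Longrightarrow> x \<in> {a..b} \<Longrightarrow> (D i has_real_derivative D (Suc i) x) (at x within {a..b})"
    and M: "\<And>x. x \<in> {a..b} \<Longrightarrow> \<bar>D 0 x\<bar> \<le> M"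
    and W: "\<And>x y. x \<in> {a..b} \<Longrightarrow> y \<in> {a..b} \<Longrightarrow> \<bar>D k x - D k y\<bar> \<le> W"
    and "j \<le> k" and "x \<in> {a..b}"
  shows "\<bar>D j x\<bar> \<le> (\<Sum>i\<in>{j..k}. trisection_const i) * (M + W * (b - a) ^ k) / (b - a) ^ j"
proof -
  define d where "d = b - a"
  have d: "d > 0" using ab by (simp add: d_def)
  have M0: "M \<ge> 0" using M[of a] ab by auto
  have W0: "W \<ge> 0" using W[of a a] ab by auto
  have "\<forall>x\<in>{a..b}. \<bar>D j x\<bar> \<le> (\<Sum>i\<in>{j..k}. trisection_const i) * (M + W * d ^ k) / d ^ j"
    using \<open>j \<le> k\<close>
  proof (induction j rule: inc_induct)
    case base
    show ?case
    proof
      fix x assume x: "x \<in> {a..b}"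
      obtain \<xi> where \<xi>: "\<xi> \<in> {a..b}" "\<bar>D k \<xi>\<bar> \<le> trisection_const k * M / d ^ k"
        using small_derivative_somewhere[of a b k D M k] ab der M unfolding d_def by blast
      have "\<bar>D k x\<bar> \<le> trisection_const k * M / d ^ k + W" using \<xi> W[OF x \<xi>(1)] by linarith
      also have "\<dots> \<le> trisection_const k * M / d ^ k + trisection_const k * W" 
        using mult_right_mono[OF trisection_const_ge_1[of k] W0] by simp
      also have "\<dots> = trisection_const k * (M + W * d ^ k) / d ^ k" using d by (simp add: field_simps)
      finally show "\<bar>D k x\<bar> \<le> (\<Sum>i\<in>{k..k}. trisection_const i) * (M + W * d ^ k) / d ^ k" by simp
    qed
  next
    case (step j)
    let ?B = "\<Sum>i\<in>{Suc j..k}. trisection_const i"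
    show ?case
    proof
      fix x assume x: "x \<in> {a..b}"
      obtain \<xi> where \<xi>: "\<xi> \<in> {a..b}" "\<bar>D j \<xi>\<bar> \<le> trisection_const j * M / d ^ j"
        using small_derivative_somewhere[of a b k D M j] ab der M step.hyps unfolding d_def by auto
      have "norm (D j x - D j \<xi>) \<le> (?B * (M + W * d ^ k) / d ^ Suc j) * norm (x - \<xi>)"
        using step der x \<xi>
        by (intro field_differentiable_bound[of "{a..b}" _ "D (Suc j)"]) auto
      also have "\<dots> \<le> (?B * (M + W * d ^ k) / d ^ Suc j) * d"
        using x \<xi> M0 W0 d trisection_const_ge_1
        by (intro mult_left_mono divide_nonneg_pos mult_nonneg_nonneg sum_nonneg)
           (auto simp: d_def intro: order_trans[of 0 1])
      also have "\<dots> = ?B * (M + W * d ^ k) / d ^ j" using d by simp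
      finally have "\<bar>D j x\<bar> \<le> trisection_const j * M / d ^ j + ?B * (M + W * d ^ k) / d ^ j"
        using \<xi>(2) by simp
      also have "\<dots> \<le> trisection_const j * (M + W * d ^ k) / d ^ j + ?B * (M + W * d ^ k) / d ^ j"
        using W0 d trisection_const_ge_1[of j]
        by (intro add_right_mono divide_right_mono mult_left_mono) auto
      also have "\<dots> = (\<Sum>i\<in>{j..k}. trisection_const i) * (M + W * d ^ k) / d ^ j"
        using step.hyps by (simp add: sum.atLeast_Suc_atMost[of j k] add_divide_distrib distrib_right)
      finally show "\<bar>D j x\<bar> \<le> \<dots>" .
    qed
  qed
  then show ?thesis using assms by (auto simp: d_def)
qed

lemma hoelder_continuous:
  assumes "g \<in> hoelder_class \<beta> L {0..1}" "\<beta> > 0"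
  shows "continuous_on {0..1} g"
proof -
  obtain k D where k: "real k < \<beta>"  "\<forall>x\<in>{0..1}. D 0 x = g x"
    "\<forall>j<k. \<forall>x\<in>{0..1}. (D j has_real_derivative D (Suc j) x) (at x within {0..1})"
    "\<forall>x\<in>{0..1}. \<forall>y\<in>{0..1}. \<bar>D k x - D k y\<bar> \<le> L * \<bar>x - y\<bar> powr (\<beta> - real k)"
    using assms unfolding hoelder_class_def by blast
  have "continuous_on {0..1} (D 0)"
  proof (cases "k = 0")
    case True
    show ?thesis unfolding continuous_on_def
    proof
      fix x :: real assume x: "x \<in> {0..1}"
      have "((\<lambda>y. L * \<bar>y - x\<bar> powr \<beta>) \<longlongrightarrow> L * \<bar>x - x\<bar> powr \<beta>) (at x within {0..1})"
        using \<open>\<beta> > 0\<close> by (intro tendsto_intros) auto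
      then have "((\<lambda>y. D 0 y - D 0 x) \<longlongrightarrow> 0) (at x within {0..1})"
        using k True x \<open>\<beta> > 0\<close>
        by (intro Lim_null_comparison[of "\<lambda>y. D 0 y - D 0 x" "\<lambda>y. L * \<bar>y - x\<bar> powr \<beta>"])
           (auto simp: eventually_at_filter)
      then show "(D 0 \<longlongrightarrow> D 0 x) (at x within {0..1})" by (simp add: LIM_zero_iff)
    qed
  next
    case False
    then show ?thesis using k(3) DERIV_continuous unfolding continuous_on_eq_continuous_within by blast
  qed
  then show ?thesis using k(2) continuous_on_cong[of "{0..1}" "{0..1}" "D 0" g] by simp
qed

text \<open>If the sup norm dominates the Hoelder bound \<open>L * \<delta> powr \<beta>\<close> at scale \<open>\<delta>\<close>, then around a
maximum point the derivative is at most a multiple of the sup norm divided by \<open>\<delta>\<close>, so that the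
function cannot lose half of its height within a fixed fraction of \<open>\<delta>\<close>. For \<open>\<beta> \<le> 1\<close> the Hoelder
condition gives this directly. The fraction \<open>\<eta>\<close> depends only on \<open>\<beta>\<close>.\<close>

lemma hoelder_plateau:
  fixes \<beta> L :: real
  assumes "\<beta> > 0" "L > 0"
  shows "\<exists>\<eta>>0. \<eta> \<le> 1 \<and> (\<forall>g\<in>hoelder_class \<beta> L {0..1}. \<forall>\<delta>>0. \<delta> \<le> 1 \<longrightarrow>
     2 * L * \<delta> powr \<beta> \<le> sup_norm_on {0..1} g \<longrightarrow>
     (\<exists>a s. 0 \<le> a \<and> a + \<eta> * \<delta> \<le> 1 \<and> s \<in> {-1, 1::real} \<and>
        (\<forall>x\<in>{a..a + \<eta> * \<delta>}. s * g x \<ge> sup_norm_on {0..1} g / 2)))"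
proof -
  define k where "k = nat (\<lceil>\<beta>\<rceil> - 1)"
  have k: "k' = k" if "real k' < \<beta>" "\<beta> \<le> real k' + 1" for k'
    using that unfolding k_def by linarith
  define B where "B = (\<Sum>i\<in>{1..k}. trisection_const i) + 1"
  have B: "B \<ge> 1" unfolding B_def using trisection_const_ge_1
    by (auto intro!: sum_nonneg intro: order_trans[of 0 1])
  define \<eta> where "\<eta> = 1 / (3 * B)"
  have \<eta>: "\<eta> > 0" "\<eta> \<le> 1" using B by (auto simp: \<eta>_def field_simps)
  have "\<exists>a s. 0 \<le> a \<and> a + \<eta> * \<delta> \<le> 1 \<and> s \<in> {-1, 1::real} \<and>
        (\<forall>x\<in>{a..a + \<eta> * \<delta>}. s * g x \<ge> sup_norm_on {0..1} g / 2)"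
    if g: "g \<in> hoelder_class \<beta> L {0..1}" and \<delta>: "\<delta> > 0" "\<delta> \<le> 1" 
      and M: "2 * L * \<delta> powr \<beta> \<le> sup_norm_on {0..1} g" for g \<delta>
  proof -
    define M where "M = sup_norm_on {0..1} g"
    obtain D where D: "\<forall>x\<in>{0..1}. D 0 x = g x" "real k < \<beta>"
      "\<forall>j<k. \<forall>x\<in>{0..1}. (D j has_real_derivative D (Suc j) x) (at x within {0..1})"
      "\<forall>x\<in>{0..1}. \<forall>y\<in>{0..1}. \<bar>D k x - D k y\<bar> \<le> L * \<bar>x - y\<bar> powr (\<beta> - real k)"
      using g k unfolding hoelder_class_def by blast
    have "continuous_on {0..1} (\<lambda>x. \<bar>g x\<bar>)" using hoelder_continuous[OF g \<open>\<beta> > 0\<close>] by (intro continuous_intros)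
    then obtain x0 where x0: "x0 \<in> {0..1}" "\<And>y. y \<in> {0..1} \<Longrightarrow> \<bar>g y\<bar> \<le> \<bar>g x0\<bar>"
      using continuous_attains_sup[of "{0..1::real}" "\<lambda>x. \<bar>g x\<bar>"] by auto
    have Mx0: "M = \<bar>g x0\<bar>" unfolding M_def sup_norm_on_def using x0 by (intro cSup_eq_maximum) auto
    \<comment> \<open>\<open>{p..p + \<delta>}\<close> contains the maximum point \<open>x0\<close> and stays inside the unit interval\<close>
  define p where "p = min x0 (1 - \<delta>)"
    have p: "0 \<le> p" "p \<le> x0" "x0 \<le> p + \<delta>" "p + \<delta> \<le> 1" using x0 \<delta> by (auto simp: p_def)
    define a where "a = min x0 (p + \<delta> - \<eta> * \<delta>)"
    have \<eta>\<delta>: "\<eta> * \<delta> \<le> \<delta>" "\<eta> * \<delta> > 0" using \<eta> \<delta> by auto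
    have a: "p \<le> a" "a \<le> x0" "x0 \<le> a + \<eta> * \<delta>" "a + \<eta> * \<delta> \<le> p + \<delta>"
      using p \<eta>\<delta> by (auto simp: a_def)
    have M': "2 * L * \<delta> powr \<beta> \<le> M" using M M_def by simp
    have near: "\<bar>g x - g x0\<bar> \<le> M / 2" if x: "x \<in> {a..a + \<eta> * \<delta>}" for x
    proof (cases "k = 0")
      case True
      have "\<bar>D k x - D k x0\<bar> \<le> L * \<bar>x - x0\<bar> powr \<beta>"
        using True D(4) x0(1) x a p by auto
      also have "\<dots> \<le> L * \<delta> powr \<beta>"
        using x a p \<open>L > 0\<close> \<open>\<beta> > 0\<close> by (intro mult_left_mono powr_mono2) auto
      finally show ?thesis using M' D(1) x a p x0(1) True by auto
    next
      case False
      have sub: "{p..p+\<delta>} \<subseteq> {0..1}" using p by auto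
      have D1: "\<bar>D 1 y\<bar> \<le> (\<Sum>i\<in>{1..k}. trisection_const i) * (M + L * \<delta> powr (\<beta> - real k) * (p + \<delta> - p) ^ k) / (p + \<delta> - p) ^ 1"
        if y: "y \<in> {p..p+\<delta>}" for y
      proof (rule intermediate_derivative_bound[where D = D and k = k and j = 1])
        fix i x assume "i < k" "x \<in> {p..p+\<delta>}"
        then show "(D i has_real_derivative D (Suc i) x) (at x within {p..p+\<delta>})"
          using D(3) sub by (intro DERIV_subset[OF _ sub]) auto
      next
        fix x assume "x \<in> {p..p+\<delta>}" then show "\<bar>D 0 x\<bar> \<le> M" using D(1) sub x0(2) Mx0 by auto
      next
        fix x y assume xy: "x \<in> {p..p+\<delta>}" "y \<in> {p..p+\<delta>}"
        have "\<bar>D k x - D k y\<bar> \<le> L * \<bar>x - y\<bar> powr (\<beta> - real k)" using xy sub D(4) by blast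
        also have "\<dots> \<le> L * \<delta> powr (\<beta> - real k)"
          using xy \<open>L > 0\<close> D(2) by (intro mult_left_mono powr_mono2) auto
        finally show "\<bar>D k x - D k y\<bar> \<le> \<dots>" .
      qed (use False y \<delta> in auto)
      have pw: "\<delta> powr (\<beta> - real k) * \<delta> ^ k = \<delta> powr \<beta>"
        using \<delta> by (simp add: powr_diff powr_realpow)
      have D1': "\<bar>D 1 y\<bar> \<le> B * (3 / 2 * M) / \<delta>" if y: "y \<in> {p..p+\<delta>}" for y
      proof -
        have "\<bar>D 1 y\<bar> \<le> (B - 1) * (M + L * \<delta> powr \<beta>) / \<delta>"
          using D1[OF y] pw by (simp add: B_def mult.assoc)
        also have "\<dots> \<le> B * (3 / 2 * M) / \<delta>"
          using B \<delta> M' Mx0 \<open>L > 0\<close> by (intro divide_right_mono mult_mono add_nonneg_nonneg) auto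
        finally show ?thesis .
      qed
      have "norm (D 0 x - D 0 x0) \<le> (B * (3 / 2 * M) / \<delta>) * norm (x - x0)"
      proof (rule field_differentiable_bound[of "{p..p+\<delta>}" _ "D 1"])
        fix z assume "z \<in> {p..p+\<delta>}"
        then show "(D 0 has_field_derivative D 1 z) (at z within {p..p + \<delta>})"
          using D(3) sub False by (intro DERIV_subset[OF _ sub]) auto
      qed (use D1' x a p in auto)
      also have "\<dots> \<le> (B * (3 / 2 * M) / \<delta>) * (\<eta> * \<delta>)"
        using x a B \<delta> Mx0 by (intro mult_left_mono) auto
      also have "\<dots> = M / 2" using B \<delta> by (simp add: \<eta>_def field_simps)
      finally show ?thesis using D(1) x a p x0(1) by auto
    qed
    define s where "s = (if g x0 \<ge> 0 then 1 else -1 :: real)"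
    have "s * g x \<ge> M / 2" if x: "x \<in> {a..a + \<eta> * \<delta>}" for x
      using near[OF x] Mx0 unfolding s_def by (simp add: abs_if split: if_splits)
    then show ?thesis using a p unfolding M_def by (intro exI[of _ a] exI[of _ s]) (auto simp: s_def)
  qed
  then show ?thesis using \<eta> by blast
qed

section \<open>Counting design points\<close>

locale design_density =
  fixes h :: "real \<Rightarrow> real" and m :: real and m' :: real
  assumes h_cont: "continuous_on {0..1} h"
    and h_density: "(LINT x:{0..1}|lborel. h x) = 1"
    and h_lower: "\<And>x. x \<in> {0..1} \<Longrightarrow> m \<le> h x" and m_pos: "m > 0"
    and h_upper: "\<And>x. x \<in> {0..1} \<Longrightarrow> h x \<le> m'"
begin

abbreviation "H \<equiv> design_cdf h"

lemma h_measurable [measurable]: "(\<lambda>x. h x * indicator {0..1} x) \<in> borel_measurable borel"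
  using borel_measurable_continuous_on_indicator[OF _ h_cont] by (simp add: mult.commute)

definition "design_law \<equiv> density lborel (\<lambda>x. ennreal (h x * indicator {0..1} x))"

lemma design_law_UNIV: "emeasure design_law UNIV = 1"
proof -
  have int: "(\<integral>x. h x * indicator {0..1} x \<partial>lborel) = 1"
    using h_density unfolding set_lebesgue_integral_def by (simp add: mult.commute)
  then have "integrable lborel (\<lambda>x. h x * indicator {0..1} x)"
    by (metis not_integrable_integral_eq zero_neq_one)
  moreover have "0 \<le> h x * indicator {0..1} x" for x
    using h_lower[of x] m_pos by (auto simp: indicator_def)
  ultimately have "(\<integral>\<^sup>+x. ennreal (h x * indicator {0..1} x) \<partial>lborel) = ennreal 1"
    using int by (subst nn_integral_eq_integral) auto
  then show ?thesis by (simp add: design_law_def emeasure_density)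
qed

sublocale design_law: real_distribution design_law
  by (intro real_distribution.intro prob_spaceI real_distribution_axioms.intro)
     (use design_law_UNIV in \<open>simp_all add: design_law_def\<close>)

lemma H_eq: "H = cdf design_law" by (simp add: design_cdf_def design_law_def)

lemma H_increment:
  assumes "0 \<le> x" "x \<le> y" "y \<le> 1"
  shows "m * (y - x) \<le> H y - H x" "H y - H x \<le> m' * (y - x)"
proof -
  have "m * (y - x) \<le> H y - H x \<and> H y - H x \<le> m' * (y - x)"
  proof (cases "x < y")
    case True
    have diff: "H y - H x = measure design_law {x<..y}" unfolding H_eq by (rule design_law.cdf_diff_eq[OF True])
    have "m' \<ge> 0" using h_lower[of 0] h_upper[of 0] m_pos by auto
    have em: "emeasure design_law {x<..y} = (\<integral>\<^sup>+z. ennreal (h z * indicator {0..1} z) * indicator {x<..y} z \<partial>lborel)"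
      by (simp add: design_law_def emeasure_density)
    have "ennreal (m * (y - x)) = (\<integral>\<^sup>+z. ennreal m * indicator {x<..y} z \<partial>lborel)"
      using m_pos assms by (simp add: nn_integral_cmult_indicator ennreal_mult)
    also have "\<dots> \<le> emeasure design_law {x<..y}" unfolding em
      using h_lower assms by (intro nn_integral_mono) (auto simp: indicator_def intro!: ennreal_leI)
    finally have 1: "ennreal (m * (y - x)) \<le> emeasure design_law {x<..y}" .
    have "emeasure design_law {x<..y} \<le> (\<integral>\<^sup>+z. ennreal m' * indicator {x<..y} z \<partial>lborel)" unfolding em
      using h_upper assms by (intro nn_integral_mono) (auto simp: indicator_def intro!: ennreal_leI)
    also have "\<dots> = ennreal (m' * (y - x))"
      using \<open>m' \<ge> 0\<close> assms by (simp add: nn_integral_cmult_indicator ennreal_mult)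
    finally have 2: "emeasure design_law {x<..y} \<le> ennreal (m' * (y - x))" .
    show ?thesis using 1 2 diff assms m_pos \<open>m' \<ge> 0\<close>
      by (simp add: design_law.emeasure_eq_measure)
  qed (use assms in auto)
  then show "m * (y - x) \<le> H y - H x" "H y - H x \<le> m' * (y - x)" by auto
qed

lemma H_0: "H 0 = 0"
proof -
  have "emeasure design_law {..0} = (\<integral>\<^sup>+z. ennreal (h z * indicator {0..1} z) * indicator {..0} z \<partial>lborel)"
    by (simp add: design_law_def emeasure_density)
  also have "\<dots> = (\<integral>\<^sup>+(z::real). 0 \<partial>lborel)"
  proof (rule nn_integral_cong_AE)
    show "AE z in lborel. ennreal (h z * indicator {0..1} z) * indicator {..0} z = 0"
      using AE_lborel_singleton[of "0::real"] by eventually_elim (auto simp: indicator_def)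
  qed
  finally show ?thesis by (simp add: H_eq cdf_def measure_def)
qed

lemma H_1: "H 1 = 1"
proof -
  have "emeasure design_law {1<..} = (\<integral>\<^sup>+z. ennreal (h z * indicator {0..1} z) * indicator {1<..} z \<partial>lborel)"
    by (simp add: design_law_def emeasure_density)
  also have "\<dots> = (\<integral>\<^sup>+(z::real). 0 \<partial>lborel)"
    by (rule nn_integral_cong) (auto simp: indicator_def)
  finally have "design_law.prob {1<..} = 0" by (simp add: measure_def)
  moreover have "design_law.prob (space design_law - {..1}) = 1 - design_law.prob {..1}" by (rule design_law.prob_compl) simp
  moreover have "space design_law - {..1} = {1<..}" by auto
  ultimately show ?thesis by (simp add: H_eq cdf_def)
qed

lemma H_mono_iff: 
  assumes "x \<in> {0..1}" "y \<in> {0..1}" shows "H x \<le> H y \<longleftrightarrow> x \<le> y"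
proof (cases "x \<le> y")
  case True
  then have "0 \<le> m * (y - x)" using m_pos by simp
  then show ?thesis using H_increment(1)[of x y] assms True by simp
next
  case False
  then have "0 < m * (x - y)" using m_pos by simp
  then show ?thesis using H_increment(1)[of y x] assms False by simp
qed

lemma H_bij: "bij_betw H {0..1} {0..1}"
proof (rule bij_betw_imageI)
  show inj: "inj_on H {0..1}" by (rule inj_onI) (metis H_mono_iff order_antisym order_refl)
  have "m'-lipschitz_on {0..1} H"
  proof (rule lipschitz_onI)
    fix x y :: real assume "x \<in> {0..1}" "y \<in> {0..1}"
    then show "dist (H x) (H y) \<le> m' * dist x y"
      using H_increment[of x y] H_increment[of y x] H_mono_iff[of x y] H_mono_iff[of y x]
      by (cases "x \<le> y") (auto simp: dist_real_def)
  qed (use h_lower[of 0] h_upper[of 0] m_pos in auto)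
  then have cont: "continuous_on {0..1} H" by (rule lipschitz_on_continuous_on)
  show "H ` {0..1} = {0..1}"
  proof (intro subset_antisym subsetI)
    fix z assume "z \<in> H ` {0..1}"
    then obtain x where x: "x \<in> {0..1}" "z = H x" by blast
    then show "z \<in> {0..1}" using H_mono_iff[of 0 x] H_mono_iff[of x 1] H_0 H_1 by auto
  next
    fix z :: real assume z: "z \<in> {0..1}"
    then show "z \<in> H ` {0..1}"
      using IVT'[of H 0 z 1] H_0 H_1 cont by (auto simp: image_iff)
  qed
qed

lemma design_props:
  assumes "i \<le> n" "n > 0"
  shows "design h n i \<in> {0..1}" "H (design h n i) = real i / real n"
proof -
  have "real i / real n \<in> H ` {0..1}" using H_bij assms by (auto simp: bij_betw_def)
  then show "design h n i \<in> {0..1}" "H (design h n i) = real i / real n"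
    using H_bij the_inv_into_into[of H "{0..1}" "real i / real n" "{0..1}"]
    unfolding design_def bij_betw_def by (auto simp: f_the_inv_into_f)
qed

lemma design_strict_mono:
  assumes "i < j" "j \<le> n" shows "design h n i < design h n j"
  using design_props[of i n] design_props[of j n] H_mono_iff[of "design h n j" "design h n i"] assms
  by (auto simp: not_le[symmetric] divide_le_cancel)

text \<open>The design points are the \<open>H\<close>-quantiles of order \<open>i / n\<close>, and \<open>H\<close> increases by at least
\<open>m * (b - a)\<close> between \<open>a\<close> and \<open>b\<close>; rounding loses at most one index at either end.\<close>

lemma many_design_points:
  assumes ab: "0 \<le> a" "a < b" "b \<le> 1" and "n > 0"
  shows "\<exists>j k. 1 \<le> j \<and> k \<le> n \<and> (\<forall>i\<in>{j..k}. design h n i \<in> {a..b}) \<and>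
           real k - real j \<ge> real n * m * (b - a) - 2"
proof -
  define j where "j = max 1 (nat \<lceil>real n * H a\<rceil>)"
  define k where "k = nat \<lfloor>real n * H b\<rfloor>"
  have Hab: "0 \<le> H a" "H b \<le> 1" "m * (b - a) \<le> H b - H a" 
    using H_mono_iff[of 0 a] H_mono_iff[of b 1] H_0 H_1 ab H_increment[of a b] by auto
  have nn: "0 \<le> real n * H a" "0 \<le> real n * H b" 
    using Hab ab m_pos order_trans[of 0 "m * (b - a)" "H b - H a"] mult_pos_pos[of m "b - a"]
    by (auto intro!: mult_nonneg_nonneg simp del: mult_pos_pos)
  have "real n * H b \<le> real n" using Hab \<open>n > 0\<close> by auto
  then have k: "k \<le> n" "real k \<le> real n * H b" "real k \<ge> real n * H b - 1"
    using nn unfolding k_def by linarith+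
  have j: "j \<ge> 1" "real j \<ge> real n * H a" "real j \<le> real n * H a + 1"
    using nn unfolding j_def by linarith+
  have "design h n i \<in> {a..b}" if i: "i \<in> {j..k}" for i
  proof -
    have i': "i \<le> n" using i k by auto
    have "real n * H a \<le> real i" "real i \<le> real n * H b" using i j k by auto
    then have "H a \<le> H (design h n i)" "H (design h n i) \<le> H b"
      using \<open>n > 0\<close> design_props[OF i' \<open>n > 0\<close>] by (auto simp: pos_le_divide_eq pos_divide_le_eq mult.commute)
    then show ?thesis
      using H_mono_iff[of a "design h n i"] H_mono_iff[of "design h n i" b] ab design_props[OF i' \<open>n > 0\<close>] by auto
  qed
  moreover have "real n * m * (b - a) \<le> real n * H b - real n * H a"
    using mult_left_mono[OF Hab(3), of "real n"] by (simp add: algebra_simps)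
  ultimately show ?thesis using j k by (intro exI[of _ j] exI[of _ k]) auto
qed

end

section \<open>Tails of random sign sums\<close>

text \<open>This is Hoeffding's bound on the moment generating function for a random sign, with its argument
rescaled.\<close>

lemma cosh_le_exp_half_square: "exp x + exp (- x) \<le> 2 * exp (x\<^sup>2 / 2)" for x :: real
proof -
  have *: "exp x + exp (- x) \<le> 2 * exp (x\<^sup>2 / 2)" if "x \<ge> 0" for x :: real
  proof -
    have "- (2*x) * (1/2) + ln (1 + 1/2 * (exp (2*x) - 1)) \<le> (2*x)\<^sup>2 / 8"
      using that by (intro Hoeffdings_lemma_aux) auto
    then have "ln ((1 + exp (2*x)) / 2) \<le> x + x\<^sup>2 / 2" by (simp add: field_simps)
    then have "(1 + exp (2*x)) / 2 \<le> exp (x + x\<^sup>2 / 2)"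
      by (metis add_pos_pos exp_gt_zero exp_le_cancel_iff exp_ln half_gt_zero zero_less_one)
    then have "exp (-x) * ((1 + exp (2*x)) / 2) \<le> exp (-x) * exp (x + x\<^sup>2 / 2)" by (intro mult_left_mono) auto
    then show ?thesis by (simp add: field_simps flip: exp_add)
  qed
  show ?thesis using *[of x] *[of "-x"] by (cases "x \<ge> 0") (auto simp: add.commute)
qed

text \<open>The Chernoff bound for random signs, phrased by counting sign vectors: the sum of exponentials over
all sign vectors factorises.\<close>

lemma rademacher_tail_one_sided:
  fixes a :: "'i \<Rightarrow> real"
  assumes "finite I" "v > 0" "(\<Sum>i\<in>I. (a i)\<^sup>2) \<le> v\<^sup>2" "t > 0"
  shows "real (card {s \<in> I \<rightarrow>\<^sub>E {-1, 1}. (\<Sum>i\<in>I. s i * a i) > t * v}) \<le> exp (- t\<^sup>2 / 2) * 2 ^ card I"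
proof -
  let ?S = "I \<rightarrow>\<^sub>E {-1, 1::real}"
  have fin: "finite ?S" using assms by (intro finite_PiE) auto
  \<comment> \<open>the exponent that minimises \<open>r\<^sup>2 * v\<^sup>2 / 2 - r * (t * v)\<close>\<close>
  define r where "r = t / v"
  have r: "r > 0" using assms by (simp add: r_def)
  have "real (card {s \<in> ?S. (\<Sum>i\<in>I. s i * a i) > t * v}) = (\<Sum>s\<in>{s \<in> ?S. (\<Sum>i\<in>I. s i * a i) > t * v}. 1)"
    by simp
  also have "\<dots> \<le> (\<Sum>s\<in>{s \<in> ?S. (\<Sum>i\<in>I. s i * a i) > t * v}. exp (r * (\<Sum>i\<in>I. s i * a i) - r * (t * v)))"
    using r by (intro sum_mono) (auto simp: mult_le_cancel_left)
  also have "\<dots> \<le> (\<Sum>s\<in>?S. exp (r * (\<Sum>i\<in>I. s i * a i) - r * (t * v)))"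
    using fin by (intro sum_mono2) auto
  also have "\<dots> = exp (- (t\<^sup>2)) * (\<Sum>s\<in>?S. \<Prod>i\<in>I. exp (s i * (r * a i)))"
    using \<open>v > 0\<close> assms(1)
    by (simp add: r_def exp_diff exp_minus sum_distrib_left exp_sum[symmetric] power2_eq_square field_simps)
  also have "(\<Sum>s\<in>?S. \<Prod>i\<in>I. exp (s i * (r * a i))) = (\<Prod>i\<in>I. \<Sum>x\<in>{-1,1}. exp (x * (r * a i)))"
    using assms by (intro prod_sum_PiE[symmetric]) auto
  also have "\<dots> \<le> (\<Prod>i\<in>I. 2 * exp ((r * a i)\<^sup>2 / 2))"
    using cosh_le_exp_half_square by (intro prod_mono) (auto simp: add.commute add_nonneg_nonneg)
  also have "\<dots> = 2 ^ card I * exp (r\<^sup>2 * (\<Sum>i\<in>I. (a i)\<^sup>2) / 2)"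
    using assms by (simp add: prod.distrib exp_sum[symmetric] power_mult_distrib sum_distrib_left sum_divide_distrib)
  also have "\<dots> \<le> 2 ^ card I * exp (r\<^sup>2 * v\<^sup>2 / 2)"
    using assms by (intro mult_left_mono) (auto intro!: mult_left_mono)
  also have "r\<^sup>2 * v\<^sup>2 = t\<^sup>2" using \<open>v > 0\<close> by (simp add: r_def power_divide)
  finally have "real (card {s \<in> ?S. (\<Sum>i\<in>I. s i * a i) > t * v}) \<le> exp (- (t\<^sup>2)) * (2 ^ card I * exp (t\<^sup>2 / 2))"
    by (simp add: mult_left_mono)
  also have "\<dots> = exp (- (t\<^sup>2) + t\<^sup>2 / 2) * 2 ^ card I" by (simp only: exp_add mult_ac)
  also have "- (t\<^sup>2) + t\<^sup>2 / 2 = - t\<^sup>2 / 2" by simp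
  finally show ?thesis .
qed

lemma rademacher_tail:
  fixes a :: "'i \<Rightarrow> real"
  assumes "finite I" "v > 0" "(\<Sum>i\<in>I. (a i)\<^sup>2) \<le> v\<^sup>2" "t > 0"
  shows "real (card {s \<in> I \<rightarrow>\<^sub>E {-1, 1}. \<bar>\<Sum>i\<in>I. s i * a i\<bar> > t * v}) \<le> 2 * exp (- t\<^sup>2 / 2) * 2 ^ card I"
proof -
  let ?A = "\<lambda>a. {s \<in> I \<rightarrow>\<^sub>E {-1, 1::real}. (\<Sum>i\<in>I. s i * a i) > t * v}"
  have "{s \<in> I \<rightarrow>\<^sub>E {-1, 1}. \<bar>\<Sum>i\<in>I. s i * a i\<bar> > t * v} = ?A a \<union> ?A (\<lambda>i. - a i)"
    by (auto simp: sum_negf abs_if)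
  then have "real (card {s \<in> I \<rightarrow>\<^sub>E {-1, 1}. \<bar>\<Sum>i\<in>I. s i * a i\<bar> > t * v}) \<le> real (card (?A a)) + real (card (?A (\<lambda>i. - a i)))"
    using card_Un_le[of "?A a" "?A (\<lambda>i. - a i)"] by (simp only: of_nat_add[symmetric] of_nat_le_iff)
  then show ?thesis
    using rademacher_tail_one_sided[of I v a t] rademacher_tail_one_sided[of I v "\<lambda>i. - a i" t] assms by simp
qed

section \<open>Variance of a double sum with independent blocks\<close>

text \<open>Expand the square into a sum over pairs of index pairs. Only those that share an index contribute,
there are at most \<open>4 * card J ^ 3\<close> of them, and each covariance is at most \<open>2 * B\<^sup>2\<close>.\<close>

lemma (in prob_space) pair_sum_variance:
  fixes X :: "'i \<Rightarrow> 'i \<Rightarrow> 'a \<Rightarrow> real"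
  assumes J: "finite J"
    and meas: "\<And>i m. i \<in> J \<Longrightarrow> m \<in> J \<Longrightarrow> X i m \<in> borel_measurable M"
    and bound: "\<And>i m \<omega>. i \<in> J \<Longrightarrow> m \<in> J \<Longrightarrow> \<omega> \<in> space M \<Longrightarrow> \<bar>X i m \<omega>\<bar> \<le> B"
    and uncorrelated: "\<And>i m i' m'. {i, m, i', m'} \<subseteq> J \<Longrightarrow> {i, m} \<inter> {i', m'} = {} \<Longrightarrow>
      expectation (\<lambda>\<omega>. X i m \<omega> * X i' m' \<omega>) = expectation (X i m) * expectation (X i' m')"
  shows "variance (\<lambda>\<omega>. \<Sum>i\<in>J. \<Sum>m\<in>J. X i m \<omega>) \<le> 8 * B\<^sup>2 * real (card J) ^ 3"
proof (cases "J = {}")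
  case False
  define Z where "Z = (\<lambda>p \<omega>. X (fst p) (snd p) \<omega>)"
  let ?P = "J \<times> J"
  have Zm [measurable]: "p \<in> ?P \<Longrightarrow> Z p \<in> borel_measurable M" for p using meas by (auto simp: Z_def)
  have Zb: "p \<in> ?P \<Longrightarrow> \<omega> \<in> space M \<Longrightarrow> \<bar>Z p \<omega>\<bar> \<le> B" for p \<omega> using bound by (auto simp: Z_def)
  have "B \<ge> 0" using Zb[of "(SOME i. i \<in> J, SOME i. i \<in> J)"] False not_empty
    by (meson abs_ge_zero all_not_in_conv bound order_trans)
  have Zi: "integrable M (Z p)" if "p \<in> ?P" for p
    using that Zb by (intro integrable_const_bound[of _ B]) auto
  have ZZb: "\<bar>Z p \<omega> * Z q \<omega>\<bar> \<le> B\<^sup>2" if "p \<in> ?P" "q \<in> ?P" "\<omega> \<in> space M" for p q \<omega>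
    using mult_mono[OF Zb[OF that(1,3)] Zb[OF that(2,3)]] \<open>B \<ge> 0\<close> by (simp add: abs_mult power2_eq_square)
  have ZZi: "integrable M (\<lambda>\<omega>. Z p \<omega> * Z q \<omega>)" if "p \<in> ?P" "q \<in> ?P" for p q
    using that ZZb by (intro integrable_const_bound[of _ "B\<^sup>2"]) auto
  have S: "(\<Sum>i\<in>J. \<Sum>m\<in>J. X i m \<omega>) = (\<Sum>p\<in>?P. Z p \<omega>)" for \<omega>
    by (simp add: sum.cartesian_product Z_def case_prod_beta)
  \<comment> \<open>the number of coincidences between the entries of \<open>p\<close> and \<open>q\<close>\<close>
  define hit where "hit = (\<lambda>(p :: 'i \<times> 'i) q. of_bool (fst p = fst q) + of_bool (fst p = snd q)
      + of_bool (snd p = fst q) + of_bool (snd p = snd q) :: real)"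
  have cov: "expectation (\<lambda>\<omega>. Z p \<omega> * Z q \<omega>) - expectation (Z p) * expectation (Z q) \<le> 2 * B\<^sup>2 * hit p q"
    if p: "p \<in> ?P" and q: "q \<in> ?P" for p q
  proof (cases "{fst p, snd p} \<inter> {fst q, snd q} = {}")
    case True
    then show ?thesis using uncorrelated[of "fst p" "snd p" "fst q" "snd q"] p q
      by (auto simp: Z_def hit_def)
  next
    case False
    then have "hit p q \<ge> 1" by (auto simp: hit_def)
    have "\<bar>expectation (Z r)\<bar> \<le> B" if "r \<in> ?P" for r
    proof -
      have "\<bar>expectation (Z r)\<bar> \<le> expectation (\<lambda>\<omega>. \<bar>Z r \<omega>\<bar>)" by (rule integral_abs_bound)
      also have "\<dots> \<le> B" using Zi[OF that] Zb[OF that] by (intro integral_le_const) (auto intro: integrable_abs)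
      finally show ?thesis .
    qed
    then have "\<bar>expectation (Z p) * expectation (Z q)\<bar> \<le> B\<^sup>2"
      using p q \<open>B \<ge> 0\<close> by (simp add: abs_mult power2_eq_square mult_mono)
    moreover have "expectation (\<lambda>\<omega>. Z p \<omega> * Z q \<omega>) \<le> B\<^sup>2"
      using ZZi[OF p q] ZZb[OF p q] by (intro integral_le_const) (auto intro: order_trans[OF abs_ge_self])
    ultimately have "expectation (\<lambda>\<omega>. Z p \<omega> * Z q \<omega>) - expectation (Z p) * expectation (Z q) \<le> 2 * B\<^sup>2 * 1" by linarith
    also have "\<dots> \<le> 2 * B\<^sup>2 * hit p q" using \<open>hit p q \<ge> 1\<close> by (intro mult_left_mono) auto
    finally show ?thesis .
  qed
  have SS: "(\<Sum>p\<in>?P. Z p \<omega>)\<^sup>2 = (\<Sum>p\<in>?P. \<Sum>q\<in>?P. Z p \<omega> * Z q \<omega>)" for \<omega>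
    by (simp add: power2_eq_square sum_product)
  have "variance (\<lambda>\<omega>. \<Sum>p\<in>?P. Z p \<omega>) =
      expectation (\<lambda>\<omega>. (\<Sum>p\<in>?P. Z p \<omega>)\<^sup>2) - (expectation (\<lambda>\<omega>. \<Sum>p\<in>?P. Z p \<omega>))\<^sup>2"
    by (rule variance_eq) (auto simp: SS intro!: Bochner_Integration.integrable_sum Zi ZZi)
  also have "expectation (\<lambda>\<omega>. (\<Sum>p\<in>?P. Z p \<omega>)\<^sup>2) = (\<Sum>p\<in>?P. \<Sum>q\<in>?P. expectation (\<lambda>\<omega>. Z p \<omega> * Z q \<omega>))"
    unfolding SS by (subst Bochner_Integration.integral_sum; (intro Bochner_Integration.integrable_sum ZZi sum.cong refl)?)
      (auto intro!: sum.cong Bochner_Integration.integral_sum ZZi)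
  also have "(expectation (\<lambda>\<omega>. \<Sum>p\<in>?P. Z p \<omega>))\<^sup>2 = (\<Sum>p\<in>?P. \<Sum>q\<in>?P. expectation (Z p) * expectation (Z q))"
    using Zi by (subst Bochner_Integration.integral_sum) (auto simp: power2_eq_square sum_product)
  also have "(\<Sum>p\<in>?P. \<Sum>q\<in>?P. expectation (\<lambda>\<omega>. Z p \<omega> * Z q \<omega>)) - \<dots>
      = (\<Sum>p\<in>?P. \<Sum>q\<in>?P. expectation (\<lambda>\<omega>. Z p \<omega> * Z q \<omega>) - expectation (Z p) * expectation (Z q))"
    by (simp add: sum_subtractf)
  also have "\<dots> \<le> (\<Sum>p\<in>?P. \<Sum>q\<in>?P. 2 * B\<^sup>2 * hit p q)"
    by (intro sum_mono cov)
  also have "\<dots> = 2 * B\<^sup>2 * (\<Sum>p\<in>?P. \<Sum>q\<in>?P. hit p q)"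
    by (simp add: sum_distrib_left)
  also have "(\<Sum>p\<in>?P. \<Sum>q\<in>?P. hit p q) = (\<Sum>p\<in>?P. 4 * real (card J))"
  proof (rule sum.cong[OF refl])
    fix p assume p: "p \<in> ?P"
    have 1: "(\<Sum>q\<in>?P. of_bool (x = fst q)) = real (card J)" if "x \<in> J" for x
    proof -
      have "(\<Sum>q\<in>?P. of_bool (x = fst q) :: real) = (\<Sum>a\<in>J. \<Sum>b\<in>J. of_bool (x = a))"
        by (simp only: sum.cartesian_product case_prod_unfold)
      also have "\<dots> = (\<Sum>a\<in>J. if x = a then real (card J) else 0)" by (intro sum.cong) auto
      also have "\<dots> = real (card J)" using J that by simp
      finally show ?thesis .
    qed
    have 2: "(\<Sum>q\<in>?P. of_bool (x = snd q)) = real (card J)" if "x \<in> J" for x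
    proof -
      have "(\<Sum>q\<in>?P. of_bool (x = snd q) :: real) = (\<Sum>a\<in>J. \<Sum>b\<in>J. of_bool (x = b))"
        by (simp only: sum.cartesian_product case_prod_unfold)
      also have "\<dots> = (\<Sum>a\<in>J. 1)" using J that by (intro sum.cong) (auto simp: of_bool_def)
      finally show ?thesis by simp
    qed
    show "(\<Sum>q\<in>?P. hit p q) = 4 * real (card J)"
      using p unfolding hit_def by (simp add: sum.distrib 1 2 mem_Times_iff)
  qed
  also have "\<dots> = 4 * real (card J) ^ 3" by (simp add: power3_eq_cube card_cartesian_product)
  finally show ?thesis by (simp add: S mult.assoc)
qed simp

section \<open>Independent symmetric errors\<close>

locale symmetric_noise =
  fixes f :: "real \<Rightarrow> real"
  assumes f_integrable: "integrable lborel f" and f_integral: "(\<integral>x. f x \<partial>lborel) = 1"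
    and f_symmetric: "\<And>x. f (- x) = f x"
    and f_pos: "\<And>x. f x > 0"
    and f_cont: "continuous_on UNIV f"
begin

definition "noise = density lborel (\<lambda>z. ennreal (f z))"

lemma f_measurable [measurable]: "f \<in> borel_measurable borel"
  using f_cont by (rule borel_measurable_continuous_onI)

lemma sets_noise [simp, measurable_cong]: "sets noise = sets borel"
  and space_noise [simp]: "space noise = UNIV"
  by (simp_all add: noise_def)

sublocale noise: prob_space noise
proof
  have "(\<integral>\<^sup>+x. ennreal (f x) \<partial>lborel) = ennreal 1"
    using f_integral f_integrable f_pos by (subst nn_integral_eq_integral) (auto intro: less_imp_le)
  then show "emeasure noise (space noise) = 1" by (simp add: noise_def emeasure_density)
qed

lemma noise_reflect: "emeasure noise {x. - x \<in> A} = emeasure noise A" if [measurable]: "A \<in> sets borel"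
proof -
  have "emeasure noise {x. - x \<in> A} = (\<integral>\<^sup>+x. ennreal (f x) * indicator A (- x) \<partial>lborel)"
    by (simp add: noise_def emeasure_density) (auto intro!: nn_integral_cong simp: indicator_def)
  also have "\<dots> = (\<integral>\<^sup>+x. ennreal (f x) * indicator A (- x) \<partial>distr lborel borel uminus)"
    by (simp add: lborel_distr_uminus)
  also have "\<dots> = (\<integral>\<^sup>+x. ennreal (f x) * indicator A x \<partial>lborel)"
    by (subst nn_integral_distr) (auto simp: f_symmetric)
  also have "\<dots> = emeasure noise A" by (simp add: noise_def emeasure_density)
  finally show ?thesis .
qed

lemma noise_singleton: "emeasure noise {x} = 0"
proof -
  have "emeasure noise {x} = (\<integral>\<^sup>+y. ennreal (f y) * indicator {x} y \<partial>lborel)"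
    by (simp add: noise_def emeasure_density)
  also have "\<dots> = (\<integral>\<^sup>+(y::real). 0 \<partial>lborel)"
  proof (rule nn_integral_cong_AE)
    show "AE y in lborel. ennreal (f y) * indicator {x} y = 0"
      using AE_lborel_singleton[of x] by eventually_elim (auto simp: indicator_def)
  qed
  finally show ?thesis by simp
qed

lemma noise_finite_null: "finite A \<Longrightarrow> emeasure noise A = 0"
proof (induction A rule: finite_induct)
  case (insert x A)
  have "emeasure noise (insert x A) \<le> emeasure noise {x} + emeasure noise A"
    using emeasure_subadditive[of "{x}" noise A] insert.hyps
    by (simp add: finite_imp_closed)
  then show ?case using insert.IH noise_singleton by simp
qed simp

lemma density_lower_bound: "\<exists>c>0. \<forall>x\<in>{a..b}. f x \<ge> c"
proof (cases "a \<le> b")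
  case True
  then have "\<exists>x\<in>{a..b}. \<forall>y\<in>{a..b}. f x \<le> f y"
    by (intro continuous_attains_inf continuous_on_subset[OF f_cont]) auto
  then show ?thesis using f_pos by blast
qed (auto intro: exI[of _ 1])

lemma noise_interval: 
  assumes "\<forall>x\<in>{a..b}. f x \<ge> c" "c \<ge> 0" "a \<le> b"
  shows "emeasure noise {a..b} \<ge> ennreal (c * (b - a))"
proof -
  have "ennreal (c * (b - a)) = (\<integral>\<^sup>+z. ennreal c * indicator {a..b} z \<partial>lborel)"
    using assms by (simp add: nn_integral_cmult_indicator ennreal_mult)
  also have "\<dots> \<le> (\<integral>\<^sup>+z. ennreal (f z) * indicator {a..b} z \<partial>lborel)"
    using assms by (intro nn_integral_mono) (auto simp: indicator_def intro!: ennreal_leI)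
  also have "\<dots> = emeasure noise {a..b}" by (simp add: noise_def emeasure_density)
  finally show ?thesis .
qed

lemma noise_interval_pos: "a < b \<Longrightarrow> emeasure noise {a..b} > 0"
  using density_lower_bound[of a b] noise_interval[of a b]
  by (smt (verit, best) ennreal_less_zero_iff less_le_trans mult_pos_pos zero_less_iff_neq_zero ennreal_eq_0_iff)

text \<open>The slope in the lower bound \<open>P (\<bar>e + e'\<bar> < 2 * \<tau>) \<ge> antidiagonal_const * \<tau>\<close> for two independent errors.\<close>

definition "antidiagonal_const = (let c = (SOME c. c > 0 \<and> (\<forall>x\<in>{-3..3}. f x \<ge> c)) in 4 * c\<^sup>2)"

text \<open>One error falls into \<open>{-1..1}\<close> with positive probability, and then the other has to fall into an
interval of length \<open>2 * \<tau>\<close> inside \<open>{-3..3}\<close>, where the density is bounded away from zero.\<close>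

lemma antidiagonal_const_pos: "antidiagonal_const > 0"
  and near_antidiagonal: "0 < \<tau> \<Longrightarrow> \<tau> \<le> 1 \<Longrightarrow>
     emeasure (noise \<Otimes>\<^sub>M noise) {z. \<bar>fst z + snd z\<bar> < 2 * \<tau>} \<ge> ennreal (antidiagonal_const * \<tau>)"
proof -
  define c where "c = (SOME c. c > 0 \<and> (\<forall>x\<in>{-3..3}. f x \<ge> c))"
  have c: "c > 0" "\<forall>x\<in>{-3..3}. f x \<ge> c"
    using someI_ex[OF density_lower_bound[of "-3" 3, unfolded Bex_def]] unfolding c_def by auto
  have pc: "antidiagonal_const = 4 * c\<^sup>2" by (simp add: antidiagonal_const_def c_def Let_def)
  show "antidiagonal_const > 0" using c pc by simp
  assume \<tau>: "0 < \<tau>" "\<tau> \<le> 1"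
  have "ennreal (antidiagonal_const * \<tau>) = ennreal (c * (2 * \<tau>)) * ennreal (c * (1 - (-1)))"
    using c \<tau> by (simp add: pc power2_eq_square ennreal_mult[symmetric] algebra_simps)
  also have "\<dots> \<le> ennreal (c * (2 * \<tau>)) * emeasure noise {-1..1}"
    using c by (intro mult_left_mono noise_interval) auto
  also have "\<dots> = (\<integral>\<^sup>+x. ennreal (c * (2 * \<tau>)) * indicator {-1..1} x \<partial>noise)"
    by (simp add: nn_integral_cmult_indicator)
  also have "\<dots> \<le> (\<integral>\<^sup>+x. emeasure noise (Pair x -` {z. \<bar>fst z + snd z\<bar> < 2 * \<tau>}) \<partial>noise)"
  proof (rule nn_integral_mono)
    fix x
    show "ennreal (c * (2 * \<tau>)) * indicator {-1..1} x \<le> emeasure noise (Pair x -` {z. \<bar>fst z + snd z\<bar> < 2 * \<tau>})"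
    proof (cases "x \<in> {-1..1}")
      case True
      have "ennreal (c * (2 * \<tau>)) = ennreal (c * ((- x + \<tau>) - (- x - \<tau>)))" by (simp add: algebra_simps)
      also have "\<dots> \<le> emeasure noise {- x - \<tau>..- x + \<tau>}"
        using True c \<tau> by (intro noise_interval) auto
      also have "\<dots> \<le> emeasure noise (Pair x -` {z. \<bar>fst z + snd z\<bar> < 2 * \<tau>})"
        using \<tau> by (intro emeasure_mono) (auto simp: vimage_def)
      finally show ?thesis using True by simp
    qed auto
  qed
  also have "\<dots> = emeasure (noise \<Otimes>\<^sub>M noise) {z. \<bar>fst z + snd z\<bar> < 2 * \<tau>}"
  proof (rule noise.emeasure_pair_measure_alt[symmetric])
    have "{z :: real \<times> real. \<bar>fst z + snd z\<bar> < 2 * \<tau>} \<in> sets borel"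
      by (intro borel_open open_Collect_less continuous_intros)
    then show "{z. \<bar>fst z + snd z\<bar> < 2 * \<tau>} \<in> sets (noise \<Otimes>\<^sub>M noise)"
      by (simp add: borel_prod[symmetric] cong: sets_pair_measure_cong)
  qed
  finally show "emeasure (noise \<Otimes>\<^sub>M noise) {z. \<bar>fst z + snd z\<bar> < 2 * \<tau>} \<ge> ennreal (antidiagonal_const * \<tau>)" .
qed

abbreviation noises :: "nat set \<Rightarrow> (nat \<Rightarrow> real) measure" where
  "noises I \<equiv> PiM I (\<lambda>_. noise)"

lemma noise_coordinate [measurable]: "i \<in> I \<Longrightarrow> (\<lambda>e. e i) \<in> borel_measurable (noises I)"
  using measurable_component_singleton[of i I "\<lambda>_. noise"]
  by (simp add: measurable_cong_sets[OF refl sets_noise])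

definition flip_signs :: "nat set \<Rightarrow> (nat \<Rightarrow> real) \<Rightarrow> (nat \<Rightarrow> real) \<Rightarrow> (nat \<Rightarrow> real)" where
  "flip_signs I s e = (\<lambda>i\<in>I. s i * e i)"

lemma flip_signs_measurable [measurable]: "flip_signs I s \<in> measurable (noises I) (noises I)"
  unfolding flip_signs_def by (rule measurable_restrict) (simp add: measurable_cong_sets[OF refl sets_noise])

text \<open>This invariance replaces conditioning on the absolute values of the errors: one averages over the
group of coordinatewise sign changes.\<close>

lemma noises_flip_invariant:
  assumes I: "finite I" and s: "\<And>i. i \<in> I \<Longrightarrow> s i \<in> {-1, 1}"
  shows "distr (noises I) (noises I) (flip_signs I s) = noises I"
proof -
  interpret product_sigma_finite "\<lambda>_::nat. noise"
    by (rule product_sigma_finite.intro) (rule noise.sigma_finite_measure_axioms)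
  show ?thesis
  proof (rule PiM_eqI)
  fix A :: "nat \<Rightarrow> real set" assume A: "\<And>i. i \<in> I \<Longrightarrow> A i \<in> sets noise"
  have "emeasure (distr (noises I) (noises I) (flip_signs I s)) (Pi\<^sub>E I A)
      = emeasure (noises I) (flip_signs I s -` (Pi\<^sub>E I A) \<inter> space (noises I))"
    using A I by (intro emeasure_distr) (auto intro: sets_PiM_I_finite)
  also have "flip_signs I s -` (Pi\<^sub>E I A) \<inter> space (noises I) = Pi\<^sub>E I (\<lambda>i. {x. s i * x \<in> A i})"
    by (auto simp: flip_signs_def space_PiM PiE_iff)
  also have "emeasure (noises I) \<dots> = (\<Prod>i\<in>I. emeasure noise {x. s i * x \<in> A i})"
    using I A by (intro emeasure_PiM) (auto intro!: measurable_sets_borel[of "\<lambda>x. s _ * x", unfolded vimage_def])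
  also have "\<dots> = (\<Prod>i\<in>I. emeasure noise (A i))"
    using s A noise_reflect by (intro prod.cong) fastforce+
  finally show "emeasure (distr (noises I) (noises I) (flip_signs I s)) (Pi\<^sub>E I A) = (\<Prod>i\<in>I. emeasure noise (A i))" .
qed (use I in auto)
qed

lemma prob_space_noises: "prob_space (noises I)"
  by (rule prob_space_PiM) (rule noise.prob_space_axioms)

lemma integral_flip:
  fixes \<phi> :: "(nat \<Rightarrow> real) \<Rightarrow> real"
  assumes "finite I" "\<And>i. i \<in> I \<Longrightarrow> s i \<in> {-1, 1}" "\<phi> \<in> borel_measurable (noises I)"
  shows "(\<integral>e. \<phi> (flip_signs I s e) \<partial>noises I) = (\<integral>e. \<phi> e \<partial>noises I)"
  using integral_distr[OF flip_signs_measurable assms(3), of s] noises_flip_invariant[OF assms(1,2)] by simp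

lemma noises_indep: 
  assumes "finite I" "I \<noteq> {}"
  shows "prob_space.indep_vars (noises I) (\<lambda>_. noise) (\<lambda>i e. e i) I"
proof -
  interpret prob_space "noises I" by (rule prob_space_noises)
  have "distr (noises I) (noises I) (\<lambda>e. \<lambda>i\<in>I. e i) = distr (noises I) (noises I) (\<lambda>e. e)"
    by (intro distr_cong) (auto simp: space_PiM PiE_restrict)
  also have "\<dots> = noises I" by (rule distr_id)
  also have "\<dots> = PiM I (\<lambda>i. distr (noises I) noise (\<lambda>e. e i))"
    by (intro PiM_cong distr_PiM_component[symmetric] noise.prob_space_axioms) auto
  finally show ?thesis using assms by (subst indep_vars_iff_distr_eq_PiM') auto
qed

lemma blocks_indep:
  assumes "finite I" "A \<subseteq> I" "B \<subseteq> I" "A \<inter> B = {}" "A \<noteq> {}"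
    "\<phi> \<in> borel_measurable (noises A)" "\<xi> \<in> borel_measurable (noises B)"
  shows "prob_space.indep_var (noises I) borel (\<lambda>e. \<phi> (restrict e A)) borel (\<lambda>e. \<xi> (restrict e B))"
proof -
  interpret prob_space "noises I" by (rule prob_space_noises)
  have "indep_var (noises A) (\<lambda>e. restrict (\<lambda>i. e i) A) (noises B) (\<lambda>e. restrict (\<lambda>i. e i) B)"
    using assms by (intro indep_var_restrict[OF noises_indep]) auto
  from indep_var_compose[OF this assms(6,7)] show ?thesis by (simp add: comp_def)
qed

lemma pair_law:
  assumes "finite I" "i \<in> I" "m \<in> I" "i \<noteq> m"
  shows "distr (noises I) (noise \<Otimes>\<^sub>M noise) (\<lambda>e. (e i, e m)) = noise \<Otimes>\<^sub>M noise"
proof -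
  interpret prob_space "noises I" by (rule prob_space_noises)
  have "indep_var noise ((\<lambda>x. x i) \<circ> (\<lambda>e. restrict (\<lambda>i. e i) {i})) noise ((\<lambda>x. x m) \<circ> (\<lambda>e. restrict (\<lambda>i. e i) {m}))"
    using assms by (intro indep_var_compose[OF indep_var_restrict[OF noises_indep]]) auto
  then have "indep_var noise (\<lambda>e. e i) noise (\<lambda>e. e m)" by (simp add: comp_def)
  then have *: "distr (noises I) noise (\<lambda>e. e i) \<Otimes>\<^sub>M distr (noises I) noise (\<lambda>e. e m)
      = distr (noises I) (noise \<Otimes>\<^sub>M noise) (\<lambda>e. (e i, e m))"
    unfolding indep_var_distribution_eq by blast
  have "distr (noises I) noise (\<lambda>e. e x) = noise" if "x \<in> I" for x
    using that by (intro distr_PiM_component noise.prob_space_axioms)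
  then show ?thesis using * assms by metis
qed

text \<open>For a fixed error \<open>e i\<close>, at most two values of the error \<open>e m\<close> produce a tie.\<close>

lemma ties_null:
  assumes "finite I" "i \<in> I" "m \<in> I" "i \<noteq> m"
  shows "AE e in noises I. \<bar>\<theta> i + e i\<bar> \<noteq> \<bar>\<theta> m + e m\<bar>"
proof -
  let ?T = "{z. \<bar>\<theta> i + fst z\<bar> = \<bar>\<theta> m + snd z\<bar>} :: (real \<times> real) set"
  have "?T \<in> sets borel" by (intro borel_closed closed_Collect_eq continuous_intros)
  then have T [measurable]: "?T \<in> sets (noise \<Otimes>\<^sub>M noise)"
    by (simp add: borel_prod[symmetric] cong: sets_pair_measure_cong)
  have "emeasure (noise \<Otimes>\<^sub>M noise) ?T = (\<integral>\<^sup>+x. emeasure noise (Pair x -` ?T) \<partial>noise)"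
    by (rule noise.emeasure_pair_measure_alt) fact
  also have "\<dots> = (\<integral>\<^sup>+x. 0 \<partial>noise)"
  proof (rule nn_integral_cong)
    fix x
    have "Pair x -` ?T \<subseteq> {\<theta> i + x - \<theta> m, - \<theta> i - x - \<theta> m}" by (auto simp: abs_if split: if_splits)
    then have "finite (Pair x -` ?T)" by (rule finite_subset) auto
    then show "emeasure noise (Pair x -` ?T) = 0" by (rule noise_finite_null)
  qed
  finally have 0: "emeasure (noise \<Otimes>\<^sub>M noise) ?T = 0" by simp
  have "emeasure (noises I) ((\<lambda>e. (e i, e m)) -` ?T \<inter> space (noises I))
      = emeasure (distr (noises I) (noise \<Otimes>\<^sub>M noise) (\<lambda>e. (e i, e m))) ?T"
    using assms by (intro emeasure_distr[symmetric] T) auto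
  also have "\<dots> = 0" unfolding pair_law[OF assms] by (rule 0)
  finally have "emeasure (noises I) ((\<lambda>e. (e i, e m)) -` ?T \<inter> space (noises I)) = 0" .
  moreover have "(\<lambda>e. (e i, e m)) -` ?T \<inter> space (noises I) = {e \<in> space (noises I). \<not> \<bar>\<theta> i + e i\<bar> \<noteq> \<bar>\<theta> m + e m\<bar>}"
    by auto
  moreover have "(\<lambda>e. (e i, e m)) -` ?T \<inter> space (noises I) \<in> sets (noises I)"
    using assms by (intro measurable_sets[OF _ T]) auto
  ultimately show ?thesis by (intro AE_I[of _ _ "{e \<in> space (noises I). \<not> \<bar>\<theta> i + e i\<bar> \<noteq> \<bar>\<theta> m + e m\<bar>}"]) auto
qed

section \<open>Signs of the larger of two observations\<close>

text \<open>The contribution of the pair \<open>(i, m)\<close> to the signed rank of observation \<open>i\<close>, where \<open>\<theta> i + e i\<close> is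
the observation: summing over \<open>m\<close> gives the sign times the local rank. Equality in the comparison
matches the convention of maximal ranks for ties.\<close>

definition signed_win :: "(nat \<Rightarrow> real) \<Rightarrow> nat \<Rightarrow> nat \<Rightarrow> (nat \<Rightarrow> real) \<Rightarrow> real" where
  "signed_win \<theta> i m e = (if \<bar>\<theta> m + e m\<bar> \<le> \<bar>\<theta> i + e i\<bar> then sgn (\<theta> i + e i) else 0)"

lemma signed_win_measurable [measurable]:
  "i \<in> I \<Longrightarrow> m \<in> I \<Longrightarrow> signed_win \<theta> i m \<in> borel_measurable (noises I)"
  unfolding signed_win_def by measurable

lemma signed_win_bound: "\<bar>signed_win \<theta> i m e\<bar> \<le> 1"
  by (auto simp: signed_win_def abs_sgn_eq)

lemma signed_win_integrable: "i \<in> I \<Longrightarrow> m \<in> I \<Longrightarrow> integrable (noises I) (signed_win \<theta> i m)"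
proof -
  interpret prob_space "noises I" by (rule prob_space_noises)
  assume "i \<in> I" "m \<in> I"
  then show ?thesis using signed_win_bound by (intro integrable_const_bound[of _ 1]) auto
qed

text \<open>For a threshold \<open>z \<ge> 0\<close> this is an odd and nondecreasing function of \<open>y\<close>. These two properties
make its mean under a symmetric law have the sign of the shift.\<close>

definition large_sgn :: "real \<Rightarrow> real \<Rightarrow> real" where
  "large_sgn z y = (if z \<le> \<bar>y\<bar> then sgn y else 0)"

lemma large_sgn_mono: "0 \<le> z \<Longrightarrow> y \<le> y' \<Longrightarrow> large_sgn z y \<le> large_sgn z y'"
  by (cases "y > 0"; cases "y' > 0"; cases "y = 0"; cases "y' = 0") (auto simp: large_sgn_def)

lemma large_sgn_symmetrized:
  assumes "0 \<le> z" "\<sigma> \<in> {-1, 1::real}" "\<sigma> * t \<ge> 0"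
  shows "\<sigma> * large_sgn z (t + x) + \<sigma> * large_sgn z (t - x) \<ge> 0"
proof -
  have odd: "large_sgn z (t - x) = - large_sgn z (x - t)"
    by (simp add: large_sgn_def abs_minus_commute) (metis minus_diff_eq sgn_minus)
  show ?thesis
    using assms large_sgn_mono[OF assms(1), of "x - t" "t + x"] large_sgn_mono[OF assms(1), of "t + x" "x - t"]
    by (auto simp: odd)
qed

text \<open>Average over the reflection of the single error \<open>e i\<close>, with \<open>e m\<close> kept fixed.\<close>

lemma signed_win_mean_nonneg:
  assumes I: "finite I" "i \<in> I" "m \<in> I" and \<sigma>: "\<sigma> \<in> {-1, 1}" "\<sigma> * \<theta> i \<ge> 0"
  shows "\<sigma> * (\<integral>e. signed_win \<theta> i m e \<partial>noises I) \<ge> 0"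
proof -
  define s :: "nat \<Rightarrow> real" where "s = (\<lambda>_. 1)(i := -1)"
  let ?w = "signed_win \<theta> i m"
  have s: "\<And>i. i \<in> I \<Longrightarrow> s i \<in> {-1, 1}" by (auto simp: s_def)
  have pt: "\<sigma> * ?w e + \<sigma> * ?w (flip_signs I s e) \<ge> 0" for e
  proof -
    \<comment> \<open>an observation always reaches its own absolute value, as if the threshold were \<open>0\<close>\<close>
    define z where "z = (if i = m then 0 else \<bar>\<theta> m + e m\<bar>)"
    have "?w e = large_sgn z (\<theta> i + e i)" "?w (flip_signs I s e) = large_sgn z (\<theta> i - e i)"
      using I by (auto simp: signed_win_def large_sgn_def z_def flip_signs_def s_def)
    then show ?thesis using large_sgn_symmetrized[of z \<sigma> "\<theta> i" "e i"] \<sigma> by (simp add: z_def)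
  qed
  have "0 \<le> (\<integral>e. \<sigma> * ?w e + \<sigma> * ?w (flip_signs I s e) \<partial>noises I)"
    by (rule Bochner_Integration.integral_nonneg) (rule pt)
  also have "\<dots> = \<sigma> * (\<integral>e. ?w e \<partial>noises I) + \<sigma> * (\<integral>e. ?w (flip_signs I s e) \<partial>noises I)"
    using I signed_win_integrable[of i I m \<theta>] integrable_distr[OF flip_signs_measurable, of I s ?w] noises_flip_invariant[OF I(1) s]
    by (subst Bochner_Integration.integral_add) auto
  also have "(\<integral>e. ?w (flip_signs I s e) \<partial>noises I) = (\<integral>e. ?w e \<partial>noises I)"
    using I s by (intro integral_flip) auto
  finally show ?thesis by simp
qed

text \<open>Without a tie, the sign of the observation of larger absolute value is the sign of the sum of both.
Reflecting both errors at once shows that the mean of this sign is the probability that the sum of the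
errors is smaller in absolute value than the sum of the shifts. Neither term alone has such a
bound: a huge \<open>\<theta> m\<close> makes it unlikely that \<open>i\<close> wins.\<close>

lemma signed_win_pair_mean:
  assumes I: "finite I" "i \<in> I" "m \<in> I" "i \<noteq> m" and \<sigma>: "\<sigma> \<in> {-1, 1}" 
    and \<tau>: "0 < \<tau>" "\<tau> \<le> 1" "\<sigma> * \<theta> i \<ge> \<tau>" "\<sigma> * \<theta> m \<ge> \<tau>"
  shows "\<sigma> * (\<integral>e. signed_win \<theta> i m e \<partial>noises I) + \<sigma> * (\<integral>e. signed_win \<theta> m i e \<partial>noises I) \<ge> antidiagonal_const * \<tau>"
proof -
  interpret P: prob_space "noises I" by (rule prob_space_noises)
  define s :: "nat \<Rightarrow> real" where "s = (\<lambda>_. -1)"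
  have s: "\<And>i. i \<in> I \<Longrightarrow> s i \<in> {-1, 1}" by (auto simp: s_def)
  define g where "g = (\<lambda>e :: nat \<Rightarrow> real. \<sigma> * sgn (\<theta> i + e i + (\<theta> m + e m)))"
  have g [measurable]: "g \<in> borel_measurable (noises I)" using I unfolding g_def by measurable
  have gb: "\<bar>g e\<bar> \<le> 1" for e using \<sigma> by (auto simp: g_def abs_sgn_eq)
  have gi: "integrable (noises I) g" using gb by (intro P.integrable_const_bound[of _ 1]) auto
  define D where "D = {e \<in> space (noises I). \<bar>e i + e m\<bar> < 2 * \<tau>}"
  have D [measurable]: "D \<in> sets (noises I)" using I unfolding D_def by measurable
  have "\<sigma> * (\<integral>e. signed_win \<theta> i m e \<partial>noises I) + \<sigma> * (\<integral>e. signed_win \<theta> m i e \<partial>noises I)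
      = (\<integral>e. \<sigma> * signed_win \<theta> i m e + \<sigma> * signed_win \<theta> m i e \<partial>noises I)"
    using I signed_win_integrable by (subst Bochner_Integration.integral_add) auto
  also have "\<dots> = (\<integral>e. g e \<partial>noises I)"
  proof (rule integral_cong_AE)
    show "AE e in noises I. \<sigma> * signed_win \<theta> i m e + \<sigma> * signed_win \<theta> m i e = g e"
      using ties_null[OF I, of \<theta>]
    proof eventually_elim
      case (elim e)
      then show ?case unfolding g_def signed_win_def sgn_real_def by (auto simp: abs_if split: if_splits)
    qed
  qed (use I in measurable)
  also have "\<dots> = ((\<integral>e. g e \<partial>noises I) + (\<integral>e. g (flip_signs I s e) \<partial>noises I)) / 2"
    using I s by (subst integral_flip) auto
  also have "\<dots> = (\<integral>e. g e + g (flip_signs I s e) \<partial>noises I) / 2"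
    using gi integrable_distr[OF flip_signs_measurable, of I s g] noises_flip_invariant[OF I(1) s]
    by (subst Bochner_Integration.integral_add) auto
  also have "\<dots> \<ge> (\<integral>e. 2 * indicator D e \<partial>noises I) / 2"
  proof (intro divide_right_mono integral_mono)
    show "integrable (noises I) (\<lambda>e. g e + g (flip_signs I s e))"
      using gi integrable_distr[OF flip_signs_measurable, of I s g] noises_flip_invariant[OF I(1) s] by auto
    show "integrable (noises I) (\<lambda>e. 2 * indicator D e :: real)"
      by (rule P.integrable_const_bound[of _ 2]) (auto simp: indicator_def)
    fix e assume "e \<in> space (noises I)"
    then show "2 * indicator D e \<le> g e + g (flip_signs I s e)"
      using I \<sigma> \<tau> unfolding D_def g_def flip_signs_def s_def sgn_real_def
      by (auto simp: indicator_def abs_if split: if_splits)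
  qed auto
  also have "(\<integral>e. 2 * indicator D e \<partial>noises I) / 2 = P.prob D" by simp
  finally have 1: "P.prob D \<le> \<sigma> * (\<integral>e. signed_win \<theta> i m e \<partial>noises I) + \<sigma> * (\<integral>e. signed_win \<theta> m i e \<partial>noises I)" .
  have "{z :: real \<times> real. \<bar>fst z + snd z\<bar> < 2 * \<tau>} \<in> sets borel"
    by (intro borel_open open_Collect_less continuous_intros)
  then have T [measurable]: "{z. \<bar>fst z + snd z\<bar> < 2 * \<tau>} \<in> sets (noise \<Otimes>\<^sub>M noise)"
    by (simp add: borel_prod[symmetric] cong: sets_pair_measure_cong)
  have "ennreal (antidiagonal_const * \<tau>) \<le> emeasure (distr (noises I) (noise \<Otimes>\<^sub>M noise) (\<lambda>e. (e i, e m))) {z. \<bar>fst z + snd z\<bar> < 2 * \<tau>}"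
    using near_antidiagonal[OF \<tau>(1,2)] I by (simp add: pair_law)
  also have "\<dots> = emeasure (noises I) ((\<lambda>e. (e i, e m)) -` {z. \<bar>fst z + snd z\<bar> < 2 * \<tau>} \<inter> space (noises I))"
    using I by (intro emeasure_distr T) auto
  also have "(\<lambda>e. (e i, e m)) -` {z. \<bar>fst z + snd z\<bar> < 2 * \<tau>} \<inter> space (noises I) = D"
    by (auto simp: D_def)
  finally have "antidiagonal_const * \<tau> \<le> P.prob D" by (simp add: P.emeasure_eq_measure)
  with 1 show ?thesis by simp
qed

section \<open>Concentration of the signed rank sum\<close>

text \<open>Chebyshev's inequality for the numerator of a local statistic. Every single mean has the sign \<open>\<sigma>\<close>,
so the weights can be replaced by \<open>wmin\<close>; afterwards the terms for \<open>(i, m)\<close> and \<open>(m, i)\<close>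
are combined.\<close>

lemma rank_sum_large:
  fixes w \<theta> :: "nat \<Rightarrow> real" and J I :: "nat set"
  assumes I: "finite I" "J \<subseteq> I" "card J \<ge> 2"
    and w: "0 < wmin" "\<And>i. i \<in> J \<Longrightarrow> wmin \<le> w i \<and> w i \<le> wmax"
    and \<sigma>: "\<sigma> \<in> {-1, 1}" and \<tau>: "0 < \<tau>" "\<tau> \<le> 1" "\<And>i. i \<in> J \<Longrightarrow> \<sigma> * \<theta> i \<ge> \<tau>"
  shows "measure (noises I) {e \<in> space (noises I).
           \<sigma> * (\<Sum>i\<in>J. \<Sum>m\<in>J. w i * signed_win \<theta> i m e) \<le> wmin * antidiagonal_const * \<tau> * (real (card J))\<^sup>2 / 8}
         \<le> 512 * wmax\<^sup>2 / (wmin\<^sup>2 * antidiagonal_const\<^sup>2 * (real (card J) * \<tau>\<^sup>2))"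
proof -
  interpret P: prob_space "noises I" by (rule prob_space_noises)
  define N where "N = real (card J)"
  have N: "N \<ge> 2" using I by (simp add: N_def)
  have J: "finite J" using I finite_subset by blast
  have wmax: "wmax \<ge> wmin" using I w(2) by (metis card.empty equals0I not_numeral_le_zero order_trans)
  define X where "X = (\<lambda>i m e. w i * signed_win \<theta> i m e)"
  define S where "S = (\<lambda>e. \<Sum>i\<in>J. \<Sum>m\<in>J. X i m e)"
  have Xm [measurable]: "i \<in> J \<Longrightarrow> m \<in> J \<Longrightarrow> X i m \<in> borel_measurable (noises I)" for i m
    unfolding X_def using I by (intro borel_measurable_times borel_measurable_const signed_win_measurable) auto
  have Xb: "\<bar>X i m e\<bar> \<le> wmax" if "i \<in> J" for i m e
  proof -
    have "\<bar>w i\<bar> * \<bar>signed_win \<theta> i m e\<bar> \<le> wmax * 1"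
      using that w wmax signed_win_bound by (intro mult_mono) force+
    then show ?thesis by (simp add: X_def abs_mult)
  qed
  have Xi: "integrable (noises I) (X i m)" if "i \<in> J" "m \<in> J" for i m
    unfolding X_def using that I signed_win_integrable[of i I m \<theta>] by auto
  have Sm [measurable]: "S \<in> borel_measurable (noises I)" unfolding S_def by measurable
  have "wmax \<ge> 0" using wmax w(1) by simp
  have var: "P.variance S \<le> 8 * wmax\<^sup>2 * N ^ 3"
    unfolding S_def N_def
  proof (rule P.pair_sum_variance)
    fix i m i' m' assume sub: "{i, m, i', m'} \<subseteq> J" and disj: "{i, m} \<inter> {i', m'} = {}"
    have "P.indep_var borel (\<lambda>e. X i m (restrict e {i, m})) borel (\<lambda>e. X i' m' (restrict e {i', m'}))"
      using sub disj I unfolding X_def by (intro blocks_indep) auto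
    moreover have "X a b (restrict e {a, b}) = X a b e" for a b e by (simp add: X_def signed_win_def)
    ultimately have "P.indep_var borel (X i m) borel (X i' m')" by simp
    then show "P.expectation (\<lambda>e. X i m e * X i' m' e) = P.expectation (X i m) * P.expectation (X i' m')"
      using sub Xi by (intro P.indep_var_lebesgue_integral) auto
  qed (use J Xb in auto)
  have mean: "\<sigma> * P.expectation S \<ge> wmin * antidiagonal_const * \<tau> * N\<^sup>2 / 4"
  proof -
    define u where "u = (\<lambda>i m. \<sigma> * P.expectation (signed_win \<theta> i m))"
    have u0: "u i m \<ge> 0" if "i \<in> J" "m \<in> J" for i m
      unfolding u_def using that I \<sigma> \<tau>(3)[OF that(1)] \<tau>(1) by (intro signed_win_mean_nonneg) auto
    have u1: "u i m + u m i \<ge> antidiagonal_const * \<tau> * of_bool (i \<noteq> m)" if "i \<in> J" "m \<in> J" for i m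
    proof (cases "i = m")
      case False
      then show ?thesis unfolding u_def using that I \<sigma> \<tau>
        by (auto intro!: signed_win_pair_mean)
    qed (use u0 that in auto)
    have "(\<Sum>i\<in>J. \<Sum>m\<in>J. of_bool (i \<noteq> m)) = N\<^sup>2 - N"
    proof -
      have "(\<Sum>m\<in>J. of_bool (i \<noteq> m)) = N - 1" if "i \<in> J" for i
      proof -
        have "(\<Sum>m\<in>J. of_bool (i \<noteq> m)) = (\<Sum>m\<in>J. 1 - (if i = m then 1 else 0 :: real))"
          by (intro sum.cong) auto
        then show ?thesis using J that by (simp add: sum_subtractf N_def)
      qed
      then have "(\<Sum>i\<in>J. \<Sum>m\<in>J. of_bool (i \<noteq> m)) = (\<Sum>i\<in>J. N - 1)" by (intro sum.cong) auto
      then show ?thesis by (simp add: N_def power2_eq_square algebra_simps)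
    qed
    then have "antidiagonal_const * \<tau> * (N\<^sup>2 - N) = (\<Sum>i\<in>J. \<Sum>m\<in>J. antidiagonal_const * \<tau> * of_bool (i \<noteq> m))"
      by (simp only: sum_distrib_left[symmetric])
    also have "\<dots> \<le> (\<Sum>i\<in>J. \<Sum>m\<in>J. u i m + u m i)" using u1 by (intro sum_mono)
    also have "\<dots> = 2 * (\<Sum>i\<in>J. \<Sum>m\<in>J. u i m)"
      using sum.swap[of u J J] by (simp add: sum.distrib)
    finally have U: "antidiagonal_const * \<tau> * (N\<^sup>2 - N) / 2 \<le> (\<Sum>i\<in>J. \<Sum>m\<in>J. u i m)" by simp
    have "\<sigma> * P.expectation S = (\<Sum>i\<in>J. \<Sum>m\<in>J. w i * u i m)"
    proof -
      have "P.expectation S = (\<Sum>i\<in>J. \<Sum>m\<in>J. P.expectation (X i m))"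
        unfolding S_def using Xi by (simp add: Bochner_Integration.integral_sum)
      then show ?thesis by (simp add: X_def u_def sum_distrib_left mult_ac)
    qed
    also have "\<dots> \<ge> (\<Sum>i\<in>J. \<Sum>m\<in>J. wmin * u i m)"
      using w u0 by (intro sum_mono mult_right_mono) auto
    also have "(\<Sum>i\<in>J. \<Sum>m\<in>J. wmin * u i m) = wmin * (\<Sum>i\<in>J. \<Sum>m\<in>J. u i m)"
      by (simp add: sum_distrib_left)
    finally have "wmin * (\<Sum>i\<in>J. \<Sum>m\<in>J. u i m) \<le> \<sigma> * P.expectation S" .
    moreover have "wmin * (antidiagonal_const * \<tau> * (N\<^sup>2 - N) / 2) \<le> wmin * (\<Sum>i\<in>J. \<Sum>m\<in>J. u i m)"
      using U w by (intro mult_left_mono) auto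
    moreover have "wmin * antidiagonal_const * \<tau> * (N\<^sup>2 / 2) \<le> wmin * antidiagonal_const * \<tau> * (N\<^sup>2 - N)"
      using w antidiagonal_const_pos \<tau> N mult_right_mono[of 2 N N] by (intro mult_left_mono) (auto simp: power2_eq_square)
    ultimately show ?thesis by simp
  qed
  \<comment> \<open>half of the lower bound for the mean, which leaves \<open>a\<close> as the admissible deviation; \<open>512 = 8 * 8\<^sup>2\<close>\<close>
  define a where "a = wmin * antidiagonal_const * \<tau> * N\<^sup>2 / 8"
  have a: "a > 0" using w antidiagonal_const_pos \<tau> N by (simp add: a_def)
  have "P.prob {e \<in> space (noises I). \<sigma> * S e \<le> a} \<le> P.prob {e \<in> space (noises I). a \<le> \<bar>S e - P.expectation S\<bar>}"
  proof (rule P.finite_measure_mono)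
    show "{e \<in> space (noises I). \<sigma> * S e \<le> a} \<subseteq> {e \<in> space (noises I). a \<le> \<bar>S e - P.expectation S\<bar>}"
    proof
      fix e assume "e \<in> {e \<in> space (noises I). \<sigma> * S e \<le> a}"
      then have e: "e \<in> space (noises I)" "\<sigma> * S e \<le> a" by auto
      have "\<sigma> * P.expectation S \<ge> 2 * a" using mean by (simp add: a_def algebra_simps)
      then have "a \<le> \<bar>S e - P.expectation S\<bar>" using e(2) \<sigma> by (cases "\<sigma> = 1") auto
      then show "e \<in> {e \<in> space (noises I). a \<le> \<bar>S e - P.expectation S\<bar>}" using e(1) by simp
    qed
  qed measurable
  also have "\<dots> \<le> P.variance S / a\<^sup>2"
  proof (rule P.Chebyshev_inequality)
    have "\<bar>S e\<bar> \<le> (\<Sum>i\<in>J. \<Sum>m\<in>J. wmax)" for e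
      unfolding S_def using Xb by (intro order_trans[OF sum_abs] sum_mono) auto
    then have "\<bar>S e\<bar>\<^sup>2 \<le> (\<Sum>i\<in>J. \<Sum>m\<in>J. wmax)\<^sup>2" for e by (intro power_mono) auto
    then show "integrable (noises I) (\<lambda>e. (S e)\<^sup>2)"
      by (intro P.integrable_const_bound[of _ "(\<Sum>i\<in>J. \<Sum>m\<in>J. wmax)\<^sup>2"]) auto
  qed (use a in auto)
  also have "\<dots> \<le> 8 * wmax\<^sup>2 * N ^ 3 / a\<^sup>2" using var by (intro divide_right_mono) auto
  also have "\<dots> = 512 * wmax\<^sup>2 / (wmin\<^sup>2 * antidiagonal_const\<^sup>2 * (N * \<tau>\<^sup>2))"
    using w antidiagonal_const_pos \<tau> N unfolding a_def by (simp add: field_simps power2_eq_square power3_eq_cube)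
  finally show ?thesis by (simp add: S_def X_def a_def N_def)
qed

end
section \<open>Bounds and measurability of the test statistic\<close>

lemma local_rank_le: "local_rank Y j k i \<le> Suc k - j"
  unfolding local_rank_def by (rule order_trans[OF card_mono[of "{j..k}"]]) auto

lemma local_rank_pos: "i \<in> {j..k} \<Longrightarrow> local_rank Y j k i \<ge> 1"
  unfolding local_rank_def by (auto simp: Suc_le_eq card_gt_0_iff)

lemma real_local_rank: "real (local_rank Y j k i) = (\<Sum>m\<in>{j..k}. if \<bar>Y m\<bar> \<le> \<bar>Y i\<bar> then 1 else 0)"
  by (simp add: local_rank_def sum.If_cases Int_def)

text \<open>Ranks are at most \<open>N = Suc k - j\<close>, which bounds the denominator by \<open>wmax * sqrt (N ^ 3)\<close>.\<close>

lemma local_statistic_lower_bound: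
  assumes "j \<le> k" and w: "\<And>i. i \<in> {j..k} \<Longrightarrow> 0 < rescaled_kernel \<psi> (X j) (X k) (X i)
      \<and> rescaled_kernel \<psi> (X j) (X k) (X i) \<le> wmax"
    and s: "\<bar>\<Sum>i=j..k. rescaled_kernel \<psi> (X j) (X k) (X i) * sgn (Y i) * real (local_rank Y j k i)\<bar> > s"
  shows "s / (wmax * sqrt (real (Suc k - j) ^ 3)) < \<bar>local_statistic \<psi> X Y j k\<bar>"
proof -
  let ?w = "\<lambda>i. rescaled_kernel \<psi> (X j) (X k) (X i)"
  let ?R = "\<lambda>i. real (local_rank Y j k i)"
  let ?N = "real (Suc k - j)"
  define den where "den = sqrt (\<Sum>i=j..k. (?w i)\<^sup>2 * (?R i)\<^sup>2)"
  have "wmax > 0" using w[of j] assms(1) by auto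
  have pos: "(\<Sum>i=j..k. (?w i)\<^sup>2 * (?R i)\<^sup>2) > 0"
  proof (intro sum_pos)
    fix i assume "i \<in> {j..k}"
    then show "0 < (?w i)\<^sup>2 * (?R i)\<^sup>2" using w[of i] local_rank_pos[of i j k Y] by auto
  qed (use assms in auto)
  then have "den > 0" by (simp add: den_def)
  have R: "?R i \<le> ?N" for i using local_rank_le[of Y j k i] by (simp only: of_nat_le_iff)
  have "(\<Sum>i=j..k. (?w i)\<^sup>2 * (?R i)\<^sup>2) \<le> (\<Sum>i=j..k. wmax\<^sup>2 * ?N\<^sup>2)"
    using w by (intro sum_mono mult_mono power_mono R) (auto intro: less_imp_le)
  also have "\<dots> = wmax\<^sup>2 * ?N ^ 3"
    by (simp only: sum_constant card_atLeastAtMost power2_eq_square power3_eq_cube mult_ac)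
  finally have "den \<le> sqrt (wmax\<^sup>2 * ?N ^ 3)" unfolding den_def by (rule real_sqrt_le_mono)
  also have "\<dots> = wmax * sqrt (?N ^ 3)" using \<open>wmax > 0\<close> by (simp add: real_sqrt_mult)
  finally have den: "den \<le> wmax * sqrt (?N ^ 3)" .
  have pos': "0 < wmax * sqrt (?N ^ 3)" using den \<open>den > 0\<close> by linarith
  let ?S = "\<bar>\<Sum>i=j..k. ?w i * sgn (Y i) * ?R i\<bar>"
  have "s / (wmax * sqrt (?N ^ 3)) < ?S / (wmax * sqrt (?N ^ 3))"
    using s pos' by (intro divide_strict_right_mono)
  also have "\<dots> \<le> ?S / den" using den \<open>den > 0\<close> pos' by (intro divide_left_mono mult_pos_pos[of _ den]) auto
  also have "\<dots> = \<bar>local_statistic \<psi> X Y j k\<bar>"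
    using \<open>den > 0\<close> pos by (simp add: local_statistic_def Let_def den_def[symmetric])
  finally show ?thesis .
qed

abbreviation sample_space :: "nat \<Rightarrow> (nat \<Rightarrow> real) measure" where
  "sample_space n \<equiv> PiM {1..n} (\<lambda>_. borel)"

lemma local_rank_measurable [measurable]:
  assumes "1 \<le> j" "k \<le> n" "i \<in> {1..n}"
  shows "(\<lambda>Y. real (local_rank Y j k i)) \<in> borel_measurable (sample_space n)"
proof -
  have [measurable]: "m \<in> {j..k} \<Longrightarrow> (\<lambda>Y. Y m) \<in> borel_measurable (sample_space n)" for m
    using assms by (intro measurable_component_singleton) auto
  have [measurable]: "(\<lambda>Y. Y i) \<in> borel_measurable (sample_space n)"
    using assms by (intro measurable_component_singleton) auto
  show ?thesis unfolding real_local_rank by measurable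
qed

lemma local_statistic_measurable [measurable]:
  assumes "1 \<le> j" "k \<le> n"
  shows "(\<lambda>Y. local_statistic \<psi> X Y j k) \<in> borel_measurable (sample_space n)"
proof -
  have [measurable]: "m \<in> {j..k} \<Longrightarrow> (\<lambda>Y. Y m) \<in> borel_measurable (sample_space n)" for m
    using assms by (intro measurable_component_singleton) auto
  have [measurable]: "m \<in> {j..k} \<Longrightarrow> (\<lambda>Y. real (local_rank Y j k m)) \<in> borel_measurable (sample_space n)" for m
    using assms by (intro local_rank_measurable) auto
  show ?thesis unfolding local_statistic_def Let_def by measurable
qed

lemma finite_index_pairs: "finite {(j, k). 1 \<le> j \<and> j < k \<and> k \<le> (n::nat)}"
  by (rule finite_subset[of _ "{..n} \<times> {..n}"]) auto

lemma multiscale_statistic_measurable [measurable]: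
  "multiscale_statistic \<psi> X n \<in> borel_measurable (sample_space n)"
  unfolding multiscale_statistic_def
  by (rule borel_measurable_Max[OF finite_index_pairs])
     (auto simp: split_beta simp del: One_nat_def
       intro!: borel_measurable_diff borel_measurable_abs local_statistic_measurable)

lemma local_le_multiscale:
  assumes "1 \<le> j" "j < k" "k \<le> n"
  shows "\<bar>local_statistic \<psi> X Y j k\<bar> - sqrt (2 * ln (real n / (real k - real j))) \<le> multiscale_statistic \<psi> X n Y"
  unfolding multiscale_statistic_def
  by (rule Max_ge) (use assms finite_index_pairs in \<open>auto intro!: finite_imageI image_eqI[of _ _ "(j, k)"]\<close>)

lemma multiscale_gt_imp_local_gt:
  assumes "n \<ge> 2" "multiscale_statistic \<psi> X n Y > C"
  shows "\<exists>j k. 1 \<le> j \<and> j < k \<and> k \<le> n \<and> \<bar>local_statistic \<psi> X Y j k\<bar> > C"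
proof -
  let ?P = "{(j, k). 1 \<le> j \<and> j < k \<and> k \<le> n}"
  let ?f = "\<lambda>(j, k). \<bar>local_statistic \<psi> X Y j k\<bar> - sqrt (2 * ln (real n / (real k - real j)))"
  have "(1, 2) \<in> ?P" using assms by auto
  then have "Max (?f ` ?P) \<in> ?f ` ?P" by (intro Max_in finite_imageI finite_index_pairs) blast
  then obtain j k where jk: "1 \<le> j" "j < k" "k \<le> n" "multiscale_statistic \<psi> X n Y = ?f (j, k)"
    unfolding multiscale_statistic_def by auto
  have "real n / (real k - real j) \<ge> 1" using jk by (simp add: field_simps)
  then have "sqrt (2 * ln (real n / (real k - real j))) \<ge> 0" by simp
  then have "\<bar>local_statistic \<psi> X Y j k\<bar> > C" using jk(4) assms(2) unfolding split by linarith
  then show ?thesis using jk by blast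
qed

lemma rank_vector_range: "rank_vector n Y \<in> {1..n} \<rightarrow>\<^sub>E {..n}"
  using local_rank_le[of Y 1 n] by (auto simp: rank_vector_def)

lemma rank_vector_set_measurable: "{Y \<in> space (sample_space n). rank_vector n Y = r} \<in> sets (sample_space n)"
proof (cases "r \<in> extensional {1..n}")
  case True
  have "{Y \<in> space (sample_space n). rank_vector n Y = r} =
     {Y \<in> space (sample_space n). \<forall>i\<in>{1..n}. real (local_rank Y 1 n i) = real (r i)}"
    using True by (auto simp: rank_vector_def extensional_def fun_eq_iff restrict_def)
  also have "\<dots> \<in> sets (sample_space n)" 
    by (intro sets.sets_Collect_finite_All borel_measurable_eq local_rank_measurable) auto
  finally show ?thesis .
next
  case False
  then have "{Y \<in> space (sample_space n). rank_vector n Y = r} = {}"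
    by (auto simp: rank_vector_def)
  then show ?thesis by (simp only: sets.empty_sets)
qed

lemma rank_vector_measurable:
  "rank_vector n \<in> measurable (sample_space n) (count_space ({1..n} \<rightarrow>\<^sub>E {..n}))"
proof (subst measurable_count_space_eq2)
  show "finite ({1..n} \<rightarrow>\<^sub>E {..n})" by (intro finite_PiE) auto
  have "rank_vector n -` {r} \<inter> space (sample_space n) \<in> sets (sample_space n)" for r
    using rank_vector_set_measurable[of n r] by (simp add: vimage_def Int_def conj_commute)
  then show "rank_vector n \<in> space (sample_space n) \<rightarrow> {1..n} \<rightarrow>\<^sub>E {..n} \<and>
     (\<forall>r\<in>{1..n} \<rightarrow>\<^sub>E {..n}. rank_vector n -` {r} \<inter> space (sample_space n) \<in> sets (sample_space n))"
    using rank_vector_range by blast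
qed

text \<open>The critical value is an arbitrary function of the rank vector, and is measurable because the rank
vector is a measurable map into a finite set.\<close>

lemma rejection_measurable:
  "{Y \<in> space (sample_space n). signed_rank_test f \<psi> X \<alpha> n Y = 1} \<in> sets (sample_space n)"
proof -
  have [measurable]: "(\<lambda>Y. conditional_quantile f \<psi> X \<alpha> n (rank_vector n Y)) \<in> borel_measurable (sample_space n)"
    by (rule measurable_compose[OF rank_vector_measurable]) simp
  have "{Y \<in> space (sample_space n). signed_rank_test f \<psi> X \<alpha> n Y = 1} =
    {Y \<in> space (sample_space n). conditional_quantile f \<psi> X \<alpha> n (rank_vector n Y) < multiscale_statistic \<psi> X n Y}"
    by (auto simp: signed_rank_test_def)
  also have "\<dots> \<in> sets (sample_space n)" by measurable
  finally show ?thesis .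
qed

section \<open>Null distribution given the ranks\<close>

(* Index sets are written {1..n} below and should keep that form under simplification. *)
declare One_nat_def [simp del]

context symmetric_noise
begin

lemma local_rank_flip_signs:
  assumes s: "\<And>i. i \<in> {1..n} \<Longrightarrow> s i \<in> {-1, 1}" and jk: "1 \<le> j" "k \<le> n" and i: "i \<in> {j..k}"
  shows "local_rank (flip_signs {1..n} s e) j k i = local_rank e j k i"
proof -
  have "\<bar>flip_signs {1..n} s e i\<bar> = \<bar>e i\<bar>" if "i \<in> {1..n}" for i
    using s[OF that] that by (auto simp: flip_signs_def abs_mult)
  then show ?thesis
    unfolding local_rank_def using jk i by (intro arg_cong[where f = card] Collect_cong) auto
qed

lemma rank_vector_flip_signs:
  assumes s: "\<And>i. i \<in> {1..n} \<Longrightarrow> s i \<in> {-1, 1}"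
  shows "rank_vector n (flip_signs {1..n} s e) = rank_vector n e"
  unfolding rank_vector_def using local_rank_flip_signs[OF s, where j = 1 and k = n] by (intro restrict_ext) auto

lemma sets_noises [simp, measurable_cong]: "sets (noises {1..n}) = sets (sample_space n)"
  by (intro sets_PiM_cong) auto

lemma space_noises [simp]: "space (noises {1..n}) = space (sample_space n)"
  by (simp add: space_PiM)

text \<open>Sign flips change neither the ranks nor the denominator, so for fixed \<open>e\<close> the statistic of a flipped
sample is a linear form in the signs, normalised by at least its Euclidean norm.\<close>

lemma flipped_statistic_tail:
  assumes jk: "1 \<le> j" "k \<le> n" and C: "C > 0"
  shows "real (card {s \<in> {1..n} \<rightarrow>\<^sub>E {-1, 1}. \<bar>local_statistic \<psi> X (flip_signs {1..n} s e) j k\<bar> > C})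
     \<le> 2 * exp (- C\<^sup>2 / 2) * 2 ^ n"
proof -
  let ?w = "\<lambda>i. rescaled_kernel \<psi> (X j) (X k) (X i)"
  let ?R = "\<lambda>i. real (local_rank e j k i)"
  define den where "den = sqrt (\<Sum>i=j..k. (?w i)\<^sup>2 * (?R i)\<^sup>2)"
  define a where "a = (\<lambda>i. if i \<in> {j..k} then ?w i * sgn (e i) * ?R i else 0)"
  have den0: "den \<ge> 0" unfolding den_def by (intro real_sqrt_ge_zero sum_nonneg) auto
  have T: "local_statistic \<psi> X (flip_signs {1..n} s e) j k = (if den \<noteq> 0 then (\<Sum>i\<in>{1..n}. s i * a i) / den else 0)"
    if s: "s \<in> {1..n} \<rightarrow>\<^sub>E {-1, 1}" for s
  proof -
    have s': "\<And>i. i \<in> {1..n} \<Longrightarrow> s i \<in> {-1, 1}" using s by auto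
    have R: "local_rank (flip_signs {1..n} s e) j k i = local_rank e j k i" if "i \<in> {j..k}" for i
      using s' jk that by (rule local_rank_flip_signs)
    have sub: "{j..k} \<subseteq> {1..n}" using jk by auto
    have "(\<Sum>i=j..k. ?w i * sgn (flip_signs {1..n} s e i) * ?R i) = (\<Sum>i=j..k. s i * a i)"
    proof (rule sum.cong[OF refl])
      fix i assume i: "i \<in> {j..k}"
      then have "s i \<in> {-1, 1}" using s' sub by blast
      then show "?w i * sgn (flip_signs {1..n} s e i) * ?R i = s i * a i"
        using i sub by (auto simp: flip_signs_def a_def sgn_mult)
    qed
    also have "\<dots> = (\<Sum>i\<in>{1..n}. s i * a i)"
      using sub by (intro sum.mono_neutral_left) (auto simp: a_def)
    finally have num: "(\<Sum>i=j..k. ?w i * sgn (flip_signs {1..n} s e i) * ?R i) = (\<Sum>i\<in>{1..n}. s i * a i)" .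
    have "local_statistic \<psi> X (flip_signs {1..n} s e) j k
      = (if den \<noteq> 0 then (\<Sum>i=j..k. ?w i * sgn (flip_signs {1..n} s e i) * ?R i) / den else 0)"
    proof -
      have "(\<Sum>i=j..k. (?w i)\<^sup>2 * (real (local_rank (flip_signs {1..n} s e) j k i))\<^sup>2) = (\<Sum>i=j..k. (?w i)\<^sup>2 * (?R i)\<^sup>2)"
        by (intro sum.cong refl) (simp only: R)
      moreover have "(\<Sum>i=j..k. ?w i * sgn (flip_signs {1..n} s e i) * real (local_rank (flip_signs {1..n} s e) j k i))
          = (\<Sum>i=j..k. ?w i * sgn (flip_signs {1..n} s e i) * ?R i)"
        by (intro sum.cong refl) (simp only: R)
      ultimately show ?thesis unfolding local_statistic_def Let_def den_def by (simp only:)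
    qed
    then show ?thesis unfolding num .
  qed
  show ?thesis
  proof (cases "den = 0")
    case True
    then have "{s \<in> {1..n} \<rightarrow>\<^sub>E {-1, 1}. \<bar>local_statistic \<psi> X (flip_signs {1..n} s e) j k\<bar> > C} = {}"
      using T C by auto
    then show ?thesis by (simp only: card.empty) simp
  next
    case False
    then have "den > 0" using den0 by simp
    have "{s \<in> {1..n} \<rightarrow>\<^sub>E {-1, 1}. \<bar>local_statistic \<psi> X (flip_signs {1..n} s e) j k\<bar> > C}
       = {s \<in> {1..n} \<rightarrow>\<^sub>E {-1, 1}. \<bar>\<Sum>i\<in>{1..n}. s i * a i\<bar> > C * den}"
      using \<open>den > 0\<close> by (intro Collect_cong conj_cong refl) (simp add: T abs_divide pos_less_divide_eq)
    moreover have "(\<Sum>i\<in>{1..n}. (a i)\<^sup>2) \<le> den\<^sup>2"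
    proof -
      have "(\<Sum>i\<in>{1..n}. (a i)\<^sup>2) = (\<Sum>i=j..k. (a i)\<^sup>2)"
        using jk by (intro sum.mono_neutral_right) (auto simp: a_def)
      also have "\<dots> \<le> (\<Sum>i=j..k. (?w i)\<^sup>2 * (?R i)\<^sup>2)"
        by (intro sum_mono) (auto simp: a_def power_mult_distrib sgn_real_def)
      also have "\<dots> = den\<^sup>2" unfolding den_def by (rule real_sqrt_pow2[symmetric]) (auto intro!: sum_nonneg)
      finally show ?thesis .
    qed
    ultimately show ?thesis using rademacher_tail[of "{1..n}" den a C] \<open>den > 0\<close> C by simp
  qed
qed

text \<open>The probability of the event is its average over all sign flips of the sample. Flips preserve the
rank vector, and for each sample with that rank vector only a small proportion of the flips makes the
statistic large.\<close>

lemma null_tail_given_rank: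
  assumes jk: "1 \<le> j" "k \<le> n" and C: "C > 0"
  shows "measure (noises {1..n}) {e \<in> space (sample_space n). \<bar>local_statistic \<psi> X e j k\<bar> > C \<and> rank_vector n e = r}
     \<le> 2 * exp (- C\<^sup>2 / 2) * measure (noises {1..n}) {e \<in> space (sample_space n). rank_vector n e = r}"
proof -
  let ?I = "{1..n}" and ?S = "{1..n} \<rightarrow>\<^sub>E {-1, 1::real}"
  interpret P: prob_space "noises ?I" by (rule prob_space_noises)
  define A where "A = {e \<in> space (sample_space n). \<bar>local_statistic \<psi> X e j k\<bar> > C \<and> rank_vector n e = r}"
  define B where "B = {e \<in> space (sample_space n). rank_vector n e = r}"
  have B: "B \<in> sets (noises ?I)" using rank_vector_set_measurable[of n r] by (simp add: B_def)
  have "{e \<in> space (sample_space n). \<bar>local_statistic \<psi> X e j k\<bar> > C} \<in> sets (sample_space n)"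
    using local_statistic_measurable[OF jk, of \<psi> X] by measurable
  moreover have "A = B \<inter> {e \<in> space (sample_space n). \<bar>local_statistic \<psi> X e j k\<bar> > C}"
    by (auto simp: A_def B_def)
  ultimately have A: "A \<in> sets (noises ?I)" using B by simp
  have finS: "finite ?S" by (intro finite_PiE) auto
  have cardS: "real (card ?S) = 2 ^ n" by (simp add: card_PiE numeral_2_eq_2[symmetric])
  have int: "integrable (noises ?I) (\<lambda>e. indicator A (flip_signs ?I s e) :: real)" for s
  proof (rule P.integrable_const_bound[of _ 1])
    show "(\<lambda>e. indicator A (flip_signs ?I s e) :: real) \<in> borel_measurable (noises ?I)"
      using A by (intro measurable_compose[OF flip_signs_measurable] borel_measurable_indicator)
  qed (auto simp: indicator_def)
  have "2 ^ n * P.prob A = (\<Sum>s\<in>?S. P.prob A)" using cardS by simp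
  also have "\<dots> = (\<Sum>s\<in>?S. \<integral>e. indicator A (flip_signs ?I s e) \<partial>noises ?I)"
  proof (rule sum.cong[OF refl])
    fix s assume "s \<in> ?S"
    then have "(\<integral>e. indicator A (flip_signs ?I s e) \<partial>noises ?I) = (\<integral>e. indicator A e \<partial>noises ?I :: real)"
      using A by (intro integral_flip) auto
    then show "P.prob A = (\<integral>e. indicator A (flip_signs ?I s e) \<partial>noises ?I)" using A by simp
  qed
  also have "\<dots> = (\<integral>e. (\<Sum>s\<in>?S. indicator A (flip_signs ?I s e)) \<partial>noises ?I)"
    using int by (subst Bochner_Integration.integral_sum) auto
  also have "\<dots> \<le> (\<integral>e. (2 * exp (- C\<^sup>2 / 2) * 2 ^ n) * indicator B e \<partial>noises ?I)"
  proof (rule integral_mono)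
    show "integrable (noises ?I) (\<lambda>e. \<Sum>s\<in>?S. indicator A (flip_signs ?I s e) :: real)"
      using int by (intro Bochner_Integration.integrable_sum)
    show "integrable (noises ?I) (\<lambda>e. (2 * exp (- C\<^sup>2 / 2) * 2 ^ n) * indicator B e :: real)"
      using B by (intro integrable_mult_right P.integrable_const_bound[of _ 1]) (auto simp: indicator_def)
    fix e assume e: "e \<in> space (noises ?I)"
    show "(\<Sum>s\<in>?S. indicator A (flip_signs ?I s e)) \<le> (2 * exp (- C\<^sup>2 / 2) * 2 ^ n) * indicator B e"
    proof (cases "e \<in> B")
      case True
      have "(\<Sum>s\<in>?S. indicator A (flip_signs ?I s e)) = real (card {s \<in> ?S. flip_signs ?I s e \<in> A})"
        using finS by (simp add: indicator_def sum.If_cases Int_def)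
      also have "\<dots> \<le> real (card {s \<in> ?S. \<bar>local_statistic \<psi> X (flip_signs ?I s e) j k\<bar> > C})"
        using finS by (intro of_nat_mono card_mono) (auto simp: A_def)
      also have "\<dots> \<le> 2 * exp (- C\<^sup>2 / 2) * 2 ^ n" by (rule flipped_statistic_tail[OF jk C])
      finally show ?thesis using True by simp
    next
      case False
      have ne: "rank_vector n e \<noteq> r" using False e by (simp add: B_def)
      have "flip_signs ?I s e \<notin> A" if "s \<in> ?S" for s
      proof -
        have "rank_vector n (flip_signs ?I s e) = rank_vector n e"
          by (rule rank_vector_flip_signs) (use that in blast)
        then show ?thesis using ne by (simp add: A_def)
      qed
      then have "(\<Sum>s\<in>?S. indicator A (flip_signs ?I s e)) = (0::real)"
        by (intro sum.neutral ballI) (simp add: indicator_def)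
      then show ?thesis using False by simp
    qed
  qed
  also have "\<dots> = 2 ^ n * (2 * exp (- C\<^sup>2 / 2) * P.prob B)" using B by simp
  finally show ?thesis unfolding A_def B_def by simp
qed

lemma regression_law_measure:
  assumes "{Y \<in> space (sample_space n). Q Y} \<in> sets (sample_space n)"
  shows "measure (regression_law f X n l) {Y \<in> space (regression_law f X n l). Q Y}
     = measure (noises {1..n}) {e \<in> space (sample_space n). Q (\<lambda>i\<in>{1..n}. l (X i) + e i)}"
    and "prob_space (regression_law f X n l)"
proof -
  have law: "regression_law f X n l = distr (noises {1..n}) (sample_space n) (\<lambda>e. \<lambda>i\<in>{1..n}. l (X i) + e i)"
    by (simp add: regression_law_def noise_def)
  have m: "(\<lambda>e. \<lambda>i\<in>{1..n}. l (X i) + e i) \<in> measurable (noises {1..n}) (sample_space n)"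
    by (rule measurable_restrict) measurable
  show "prob_space (regression_law f X n l)" unfolding law by (rule prob_space.prob_space_distr[OF prob_space_noises m])
  show "measure (regression_law f X n l) {Y \<in> space (regression_law f X n l). Q Y}
     = measure (noises {1..n}) {e \<in> space (sample_space n). Q (\<lambda>i\<in>{1..n}. l (X i) + e i)}"
    unfolding law using assms
    by (subst measure_distr[OF m]) (auto intro!: arg_cong[where f = "measure _"] simp: space_PiM)
qed

lemma null_law_measure:
  assumes "{Y \<in> space (sample_space n). Q Y} \<in> sets (sample_space n)"
  shows "measure (regression_law f X n (\<lambda>_. 0)) {Y \<in> space (regression_law f X n (\<lambda>_. 0)). Q Y}
     = measure (noises {1..n}) {e \<in> space (sample_space n). Q e}"
proof -
  have "(\<lambda>i\<in>{1..n}. 0 + e i) = e" if "e \<in> space (sample_space n)" for e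
    using that by (auto simp: space_PiM PiE_iff extensional_def fun_eq_iff)
  then have "{e \<in> space (sample_space n). Q (\<lambda>i\<in>{1..n}. 0 + e i)} = {e \<in> space (sample_space n). Q e}"
    by (intro Collect_cong conj_cong refl) simp
  then show ?thesis unfolding regression_law_measure(1)[OF assms] by (simp only:)
qed

text \<open>A union bound over the index pairs. If the rank vector had probability zero, the conditional
probability would be \<open>0 / 0 = 0\<close> and no critical value would be admissible for \<open>\<alpha> < 1\<close>.\<close>

lemma quantile_le:
  assumes pos: "measure (noises {1..n}) {e \<in> space (sample_space n). rank_vector n e = r} > 0"
    and n: "n \<ge> 2" and C: "C > 0" and small: "2 * (real n)\<^sup>2 * exp (- C\<^sup>2 / 2) \<le> \<alpha>"
  shows "conditional_quantile f \<psi> X \<alpha> n r \<le> C"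
proof -
  let ?P = "regression_law f X n (\<lambda>_. 0)"
  interpret P: prob_space "noises {1..n}" by (rule prob_space_noises)
  define B where "B = {e \<in> space (sample_space n). rank_vector n e = r}"
  define A where "A = (\<lambda>(j, k). {e \<in> space (sample_space n). \<bar>local_statistic \<psi> X e j k\<bar> > C \<and> rank_vector n e = r})"
  let ?J = "{(j, k). 1 \<le> j \<and> j < k \<and> k \<le> n}"
  have B: "B \<in> sets (sample_space n)" unfolding B_def by (rule rank_vector_set_measurable)
  have Am: "A p \<in> sets (sample_space n)" if pJ: "p \<in> ?J" for p
  proof -
    obtain j k where p: "p = (j, k)" "1 \<le> j" "k \<le> n" using pJ by (cases p) auto
    have "{e \<in> space (sample_space n). \<bar>local_statistic \<psi> X e j k\<bar> > C} \<in> sets (sample_space n)"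
      using local_statistic_measurable[OF p(2,3), of \<psi> X] by measurable
    moreover have "A p = B \<inter> {e \<in> space (sample_space n). \<bar>local_statistic \<psi> X e j k\<bar> > C}"
      by (auto simp: A_def B_def p)
    ultimately show ?thesis using B by simp
  qed
  define G where "G = {e \<in> space (sample_space n). multiscale_statistic \<psi> X n e \<le> C \<and> rank_vector n e = r}"
  have Gm: "G \<in> sets (sample_space n)"
  proof -
    have "{e \<in> space (sample_space n). multiscale_statistic \<psi> X n e \<le> C} \<in> sets (sample_space n)" by measurable
    moreover have "G = B \<inter> {e \<in> space (sample_space n). multiscale_statistic \<psi> X n e \<le> C}"
      by (auto simp: G_def B_def)
    ultimately show ?thesis using B by simp
  qed
  have "B - G \<subseteq> (\<Union>p\<in>?J. A p)"
  proof
    fix e assume e: "e \<in> B - G"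
    then have "multiscale_statistic \<psi> X n e > C" by (auto simp: B_def G_def)
    from multiscale_gt_imp_local_gt[OF n this] e show "e \<in> (\<Union>p\<in>?J. A p)"
      by (auto simp: A_def B_def)
  qed
  then have "P.prob (B - G) \<le> P.prob (\<Union>p\<in>?J. A p)"
    using Am finite_index_pairs by (intro P.finite_measure_mono) (auto intro!: sets.finite_UN)
  also have "\<dots> \<le> (\<Sum>p\<in>?J. P.prob (A p))"
    using Am finite_index_pairs by (intro P.finite_measure_subadditive_finite) auto
  also have "\<dots> \<le> (\<Sum>p\<in>?J. 2 * exp (- C\<^sup>2 / 2) * P.prob B)"
  proof (rule sum_mono)
    fix p assume "p \<in> ?J"
    then obtain j k where p: "p = (j, k)" "1 \<le> j" "k \<le> n" by (cases p) auto
    show "P.prob (A p) \<le> 2 * exp (- C\<^sup>2 / 2) * P.prob B"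
      using null_tail_given_rank[OF p(2,3) C, of \<psi> X r] by (simp only: A_def B_def p(1) split)
  qed
  also have "\<dots> = real (card ?J) * (2 * exp (- C\<^sup>2 / 2) * P.prob B)" by simp
  also have "\<dots> \<le> (real n)\<^sup>2 * (2 * exp (- C\<^sup>2 / 2) * P.prob B)"
  proof (intro mult_right_mono)
    have "card ?J \<le> card ({1..n} \<times> {1..n})" by (intro card_mono) auto
    also have "\<dots> = n\<^sup>2" by (simp add: card_cartesian_product power2_eq_square)
    finally have "card ?J \<le> n\<^sup>2" .
    then show "real (card ?J) \<le> (real n)\<^sup>2" by (simp only: of_nat_power[symmetric] of_nat_le_iff)
  qed auto
  also have "\<dots> \<le> \<alpha> * P.prob B" using mult_right_mono[OF small, of "P.prob B"] by (simp add: mult_ac)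
  finally have BG: "P.prob (B - G) \<le> \<alpha> * P.prob B" .
  have "P.prob (B - G) = P.prob B - P.prob G"
    using B Gm by (intro P.finite_measure_Diff) (auto simp: B_def G_def)
  then have "P.prob G \<ge> (1 - \<alpha>) * P.prob B" using BG by (simp add: algebra_simps)
  then have "P.prob G / P.prob B \<ge> 1 - \<alpha>" using pos by (simp add: B_def pos_le_divide_eq)
  moreover have "cond_prob ?P (\<lambda>Y. multiscale_statistic \<psi> X n Y \<le> C) (\<lambda>Y. rank_vector n Y = r) = P.prob G / P.prob B"
    unfolding cond_prob_def using Gm B unfolding G_def B_def by (simp only: null_law_measure)
  ultimately show ?thesis
    unfolding conditional_quantile_def using C
    by (intro cInf_lower) (auto intro!: bdd_belowI[of _ 0])
qed

text \<open>Errors \<open>e i\<close> within \<open>1/2\<close> above the rank of \<open>Y i\<close> are ordered like the absolute values of \<open>Y\<close>,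
since distinct ranks differ by at least one. They form a box, which has positive probability.\<close>

lemma tie_free_rank_positive:
  assumes "\<And>i m. i \<in> {1..n} \<Longrightarrow> m \<in> {1..n} \<Longrightarrow> i \<noteq> m \<Longrightarrow> \<bar>Y i\<bar> \<noteq> \<bar>Y m\<bar>"
  shows "measure (noises {1..n}) {e \<in> space (sample_space n). rank_vector n e = rank_vector n Y} > 0"
proof -
  interpret P: prob_space "noises {1..n}" by (rule prob_space_noises)
  interpret product_sigma_finite "\<lambda>_::nat. noise"
    by (rule product_sigma_finite.intro) (rule noise.sigma_finite_measure_axioms)
  define r where "r = (\<lambda>i. real (local_rank Y 1 n i))"
  have r: "r m \<le> r i \<longleftrightarrow> \<bar>Y m\<bar> \<le> \<bar>Y i\<bar>" if "i \<in> {1..n}" "m \<in> {1..n}" for i m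
  proof
    assume "\<bar>Y m\<bar> \<le> \<bar>Y i\<bar>"
    then have "local_rank Y 1 n m \<le> local_rank Y 1 n i"
      unfolding local_rank_def by (intro card_mono) auto
    then show "r m \<le> r i" by (simp add: r_def)
  next
    assume le: "r m \<le> r i"
    show "\<bar>Y m\<bar> \<le> \<bar>Y i\<bar>"
    proof (rule ccontr)
      assume "\<not> \<bar>Y m\<bar> \<le> \<bar>Y i\<bar>"
      then have "local_rank Y 1 n i < local_rank Y 1 n m"
        unfolding local_rank_def using that by (intro psubset_card_mono) auto
      then show False using le by (simp add: r_def)
    qed
  qed
  define box where "box = (\<Pi>\<^sub>E i\<in>{1..n}. {r i..r i + 1/2})"
  have "box \<subseteq> {e \<in> space (sample_space n). rank_vector n e = rank_vector n Y}"
  proof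
    fix e assume e: "e \<in> box"
    then have ei: "r i \<le> e i" "e i \<le> r i + 1/2" "0 \<le> e i" if "i \<in> {1..n}" for i
      using that order_trans[of 0 "r i" "e i"] by (auto simp: box_def r_def PiE_iff)
    have iff: "\<bar>e m\<bar> \<le> \<bar>e i\<bar> \<longleftrightarrow> \<bar>Y m\<bar> \<le> \<bar>Y i\<bar>" if im: "i \<in> {1..n}" "m \<in> {1..n}" for i m
    proof (cases "i = m")
      case False
      then have ne: "r i \<noteq> r m" using r[OF im] r[OF im(2,1)] assms[OF im False] by force
      have "r m \<le> r i \<longleftrightarrow> e m \<le> e i"
      proof
        assume "r m \<le> r i"
        then have "r m + 1 \<le> r i" using ne by (simp add: r_def)
        then show "e m \<le> e i" using ei[OF im(1)] ei[OF im(2)] by linarith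
      next
        assume "e m \<le> e i"
        then have "r m \<le> r i + 1/2" using ei[OF im(1)] ei[OF im(2)] by linarith
        then show "r m \<le> r i" by (simp add: r_def)
      qed
      then show ?thesis using r[OF im] ei[OF im(1)] ei[OF im(2)] by simp
    qed simp
    then have "rank_vector n e = rank_vector n Y"
      unfolding rank_vector_def local_rank_def by (intro restrict_ext arg_cong[where f = card] Collect_cong) blast
    then show "e \<in> {e \<in> space (sample_space n). rank_vector n e = rank_vector n Y}"
      using e by (auto simp: box_def space_PiM)
  qed
  moreover have "{e \<in> space (sample_space n). rank_vector n e = rank_vector n Y} \<in> sets (noises {1..n})"
    using rank_vector_set_measurable by simp
  ultimately have "emeasure (noises {1..n}) box \<le> emeasure (noises {1..n}) {e \<in> space (sample_space n). rank_vector n e = rank_vector n Y}"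
    by (intro emeasure_mono)
  moreover have "emeasure (noises {1..n}) box = (\<Prod>i\<in>{1..n}. emeasure noise {r i..r i + 1/2})"
    unfolding box_def by (intro emeasure_PiM) auto
  moreover have "(\<Prod>i\<in>{1..n}. emeasure noise {r i..r i + 1/2}) > 0"
    using noise_interval_pos by (simp add: prod_zero_iff zero_less_iff_neq_zero)
  ultimately have "0 < emeasure (noises {1..n}) {e \<in> space (sample_space n). rank_vector n e = rank_vector n Y}"
    by (simp only: less_le_trans)
  then show ?thesis by (simp only: P.emeasure_eq_measure ennreal_less_zero_iff)
qed

end
section \<open>Power of the test\<close>

text \<open>Almost surely there are no ties, so that the critical value is at most \<open>C\<close>. The rejection event then
contains the event that the signed rank sum over \<open>{j..k}\<close> is large.\<close>

lemma (in symmetric_noise) rejection_probability: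
  assumes n: "n \<ge> 2" and jk: "1 \<le> j" "j < k" "k \<le> n"
    and w: "0 < wmin" "\<And>i. i \<in> {j..k} \<Longrightarrow> wmin \<le> rescaled_kernel \<psi> (X j) (X k) (X i)
      \<and> rescaled_kernel \<psi> (X j) (X k) (X i) \<le> wmax"
    and \<sigma>: "\<sigma> \<in> {-1, 1}" and \<tau>: "0 < \<tau>" "\<tau> \<le> 1" "\<And>i. i \<in> {j..k} \<Longrightarrow> \<sigma> * l (X i) \<ge> \<tau>"
    and C: "C > 0" "2 * (real n)\<^sup>2 * exp (- C\<^sup>2 / 2) \<le> \<alpha>"
    and big: "C + sqrt (2 * ln (real n)) \<le> wmin * antidiagonal_const / (8 * wmax) * (sqrt (real (Suc k - j)) * \<tau>)"
  shows "\<P>(Y in regression_law f X n l. signed_rank_test f \<psi> X \<alpha> n Y = 1)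
    \<ge> 1 - 512 * wmax\<^sup>2 / (wmin\<^sup>2 * antidiagonal_const\<^sup>2 * (real (Suc k - j) * \<tau>\<^sup>2))"
proof -
  let ?I = "{1..n}" and ?J = "{j..k}" and ?N = "real (Suc k - j)"
  let ?w = "\<lambda>i. rescaled_kernel \<psi> (X j) (X k) (X i)"
  interpret P: prob_space "noises ?I" by (rule prob_space_noises)
  have "wmax > 0" using w(1) w(2)[of j] jk by auto
  have N: "?N \<ge> 2" using jk by auto
  define Y where "Y = (\<lambda>e. \<lambda>i\<in>?I. l (X i) + e i)"
  define S where "S = (\<lambda>e. \<Sum>i\<in>?J. \<Sum>m\<in>?J. ?w i * signed_win (l \<circ> X) i m e)"
  define G where "G = {e \<in> space (noises ?I). \<sigma> * S e > wmin * antidiagonal_const * \<tau> * ?N\<^sup>2 / 8}"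
  define R where "R = {e \<in> space (sample_space n). signed_rank_test f \<psi> X \<alpha> n (Y e) = 1}"
  have YM: "Y \<in> measurable (noises ?I) (sample_space n)" unfolding Y_def by (rule measurable_restrict) measurable
  have R: "R \<in> sets (noises ?I)"
  proof -
    have "R = Y -` {y \<in> space (sample_space n). signed_rank_test f \<psi> X \<alpha> n y = 1} \<inter> space (noises ?I)"
      using measurable_space[OF YM] by (auto simp: R_def)
    then show ?thesis using measurable_sets[OF YM rejection_measurable[of n f \<psi> X \<alpha>]] by (simp only:)
  qed
  have SM: "S \<in> borel_measurable (noises ?I)"
    unfolding S_def using jk
    by (intro borel_measurable_sum borel_measurable_times borel_measurable_const signed_win_measurable) auto
  have G: "G \<in> sets (noises ?I)" unfolding G_def using SM by measurable
  define err where "err = 512 * wmax\<^sup>2 / (wmin\<^sup>2 * antidiagonal_const\<^sup>2 * (?N * \<tau>\<^sup>2))"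
  have "P.prob (space (noises ?I) - G) \<le> err"
  proof -
    have "space (noises ?I) - G = {e \<in> space (noises ?I). \<sigma> * S e \<le> wmin * antidiagonal_const * \<tau> * (real (card ?J))\<^sup>2 / 8}"
      by (auto simp: G_def)
    moreover have "P.prob {e \<in> space (noises ?I). \<sigma> * S e \<le> wmin * antidiagonal_const * \<tau> * (real (card ?J))\<^sup>2 / 8}
        \<le> 512 * wmax\<^sup>2 / (wmin\<^sup>2 * antidiagonal_const\<^sup>2 * (real (card ?J) * \<tau>\<^sup>2))"
      unfolding S_def using jk w \<sigma> \<tau> by (intro rank_sum_large) auto
    ultimately show ?thesis by (simp only: card_atLeastAtMost err_def)
  qed
  then have PG: "1 - err \<le> P.prob G"
    using P.prob_compl[OF G] by linarith
  have ties: "AE e in noises ?I. \<forall>i\<in>?I. \<forall>m\<in>?I. i \<noteq> m \<longrightarrow> \<bar>(l \<circ> X) i + e i\<bar> \<noteq> \<bar>(l \<circ> X) m + e m\<bar>"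
    by (intro AE_finite_allI AE_impI ties_null) auto
  have "P.prob G \<le> P.prob R"
  proof (rule P.finite_measure_mono_AE[OF _ R])
    show "AE e in noises ?I. e \<in> G \<longrightarrow> e \<in> R"
      using ties AE_space
    proof eventually_elim
      case (elim e)
      show ?case
      proof
        assume e: "e \<in> G"
        have "(\<Sum>i=j..k. ?w i * sgn (Y e i) * real (local_rank (Y e) j k i)) = S e"
        proof -
          have sub: "?J \<subseteq> ?I" using jk by auto
          have "?w i * sgn (Y e i) * real (local_rank (Y e) j k i) = (\<Sum>m\<in>?J. ?w i * signed_win (l \<circ> X) i m e)"
            if i: "i \<in> ?J" for i
            unfolding real_local_rank sum_distrib_left
            by (intro sum.cong refl) (use i sub in \<open>auto simp: signed_win_def Y_def\<close>)
          then show ?thesis unfolding S_def by (intro sum.cong refl) 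
        qed
        moreover have "\<bar>S e\<bar> > wmin * antidiagonal_const * \<tau> * ?N\<^sup>2 / 8"
          using e \<sigma> unfolding G_def by auto
        ultimately have "wmin * antidiagonal_const * \<tau> * ?N\<^sup>2 / 8 / (wmax * sqrt (?N ^ 3)) < \<bar>local_statistic \<psi> X (Y e) j k\<bar>"
          using jk w by (intro local_statistic_lower_bound) force+
        also have "wmin * antidiagonal_const * \<tau> * ?N\<^sup>2 / 8 / (wmax * sqrt (?N ^ 3)) = wmin * antidiagonal_const / (8 * wmax) * (sqrt ?N * \<tau>)"
        proof -
          have "sqrt (?N ^ 3) = ?N * sqrt ?N" using N by (simp add: power3_eq_cube real_sqrt_mult)
          moreover have "?N\<^sup>2 = (?N * sqrt ?N) * sqrt ?N" using N by (simp add: power2_eq_square mult.assoc)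
          ultimately show ?thesis using N \<open>wmax > 0\<close> by (simp add: divide_simps)
        qed
        finally have "C + sqrt (2 * ln (real n)) < \<bar>local_statistic \<psi> X (Y e) j k\<bar>" using big by linarith
        moreover have "sqrt (2 * ln (real n / (real k - real j))) \<le> sqrt (2 * ln (real n))"
        proof -
          have "real k - real j \<ge> 1" using jk by linarith
          then have "real n / (real k - real j) \<le> real n / 1" "real n / (real k - real j) > 0"
            using n by (auto intro!: divide_left_mono divide_pos_pos simp del: div_by_1)
          then show ?thesis by simp
        qed
        ultimately have "multiscale_statistic \<psi> X n (Y e) > C"
          using local_le_multiscale[OF jk, of \<psi> X "Y e"] by linarith
        moreover have "conditional_quantile f \<psi> X \<alpha> n (rank_vector n (Y e)) \<le> C"
          using elim(1) by (intro quantile_le tie_free_rank_positive n C) (auto simp: Y_def)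
        ultimately show "e \<in> R" using elim(2) by (simp add: R_def signed_rank_test_def)
      qed
    qed
  qed
  also have "P.prob R = \<P>(Y in regression_law f X n l. signed_rank_test f \<psi> X \<alpha> n Y = 1)"
    unfolding R_def Y_def by (rule regression_law_measure(1)[OF rejection_measurable, symmetric])
  finally show ?thesis using PG unfolding err_def by (rule order_trans[rotated])
qed

lemma continuous_positive_bounds:
  fixes g :: "real \<Rightarrow> real"
  assumes "continuous_on {0..1} g" "\<And>x. x \<in> {0..1} \<Longrightarrow> g x > 0"
  shows "\<exists>m m'. m > 0 \<and> (\<forall>x\<in>{0..1}. m \<le> g x \<and> g x \<le> m')"
proof -
  obtain a where a: "a \<in> {0..1}" "\<forall>x\<in>{0..1}. g a \<le> g x"
    using continuous_attains_inf[OF compact_Icc _ assms(1)] by auto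
  obtain b where b: "\<forall>x\<in>{0..1}. g x \<le> g b"
    using continuous_attains_sup[OF compact_Icc _ assms(1)] by auto
  have "g a > 0" using a(1) by (rule assms(2))
  then show ?thesis using a(2) b by blast
qed

lemma rate_limits:
  fixes \<beta> :: real assumes "\<beta> > 0"
  shows "filterlim (\<lambda>n. real n * (ln (real n) / real n) powr (1 / (2 * \<beta> + 1))) at_top sequentially"
    and "rate \<beta> \<longlonglongrightarrow> 0"
proof -
  define p where "p = 1 / (2 * \<beta> + 1)"
  have p: "0 < p" "p < 1" using assms by (auto simp: p_def)
  show "filterlim (\<lambda>n. real n * (ln (real n) / real n) powr (1 / (2 * \<beta> + 1))) at_top sequentially"
    unfolding p_def[symmetric] using p by real_asymp
  define q where "q = \<beta> / (2 * \<beta> + 1)"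
  have q: "0 < q" using assms by (auto simp: q_def)
  show "rate \<beta> \<longlonglongrightarrow> 0"
    unfolding rate_def[abs_def] q_def[symmetric] using q by real_asymp
qed

theorem theorem4:
  fixes f h \<psi> :: "real \<Rightarrow> real" and \<beta> L :: real
  assumes f_density: "integrable lborel f" "(\<integral>x. f x \<partial>lborel) = 1"
    and f_symmetric: "\<And>x. f (- x) = f x"
    and h_pos: "\<And>x. x \<in> {0..1} \<Longrightarrow> h x > 0"
    and h_cont: "continuous_on {0..1} h"
    and h_density: "(LINT x:{0..1}|lborel. h x) = 1"
    and h_variation: "bounded_variation_on h {0..1}"
    and h_modulus:
      "(\<lambda>\<delta>. SUP (x, y)\<in>{(x, y). x \<in> {0..1} \<and> y \<in> {0..1} \<and> \<bar>x - y\<bar> \<le> \<delta>}. \<bar>h x - h y\<bar>)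
         \<in> O[at_right 0](\<lambda>\<delta>. 1 / ln (1 / \<delta>))"
    and f_pos: "\<And>x. f x > 0"
    and f_abs_cont: "abs_continuous_on f UNIV"
    and f_differentiable: "\<And>x. f differentiable (at x)"
    and f_deriv_bounded: "bounded (range (deriv f))"
    and f_deriv_integrable: "integrable lborel (deriv f)"
    and f_fisher: "integrable lborel (\<lambda>x. (deriv f x / f x)\<^sup>2 * f x)"
    and f_expansion:
      "\<exists>\<delta>\<^sub>0>0. \<exists>r :: real \<Rightarrow> real \<Rightarrow> real. \<exists>K. \<forall>\<^sub>F \<theta> in at 0. \<forall>\<delta>\<in>{0<..\<delta>\<^sub>0}.
         integrable lborel (\<lambda>z. ((f (z + \<theta>) / f z) powr (1 + \<delta>) - 1) * f z) \<and>
         (\<integral>z. ((f (z + \<theta>) / f z) powr (1 + \<delta>) - 1) * f z \<partial>lborel) =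
           1 / 2 * \<delta> * (1 + \<delta>) * \<theta>\<^sup>2 * fisher_information f * (1 + r \<theta> \<delta>) \<and>
         \<bar>r \<theta> \<delta>\<bar> \<le> K * (1 / ln (1 / \<bar>\<theta>\<bar>))"
    and psi_pos: "\<And>x. x \<in> {0..1} \<Longrightarrow> \<psi> x > 0"
    and psi_cont: "continuous_on {0..1} \<psi>"
    and psi_variation: "bounded_variation_on \<psi> {0..1}"
    and psi_integral: "(LINT x:{0..1}|lborel. \<psi> x) = 1"
    and beta_pos: "\<beta> > 0" and L_pos: "L > 0"
  shows "\<exists>c \<ge> d_star f \<beta> L. \<forall>\<alpha>\<in>{0<..<1}.
    liminf (\<lambda>n. INF l\<in>{l \<in> weighted_hoelder_class h \<beta> L.
                        sup_norm_on {0..1} (\<lambda>x. l x * sqrt (h x)) \<ge> c * rate \<beta> n}.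
      ereal \<P>(Y in regression_law f (design h n) n l.
               signed_rank_test f \<psi> (design h n) \<alpha> n Y = 1)) = 1"
proof -
  have "continuous_on UNIV f"
    using f_differentiable
    by (meson continuous_at_imp_continuous_on differentiable_imp_continuous_within)
  then interpret symmetric_noise f
    by unfold_locales (use f_density f_symmetric f_pos in auto)
  obtain m m' where m: "m > 0" "\<And>x. x \<in> {0..1} \<Longrightarrow> m \<le> h x \<and> h x \<le> m'"
    using continuous_positive_bounds[OF h_cont h_pos] by blast
  interpret design_density h m m'
    by unfold_locales (use m h_cont h_density in auto)
  have m': "m' > 0" using m(1) m(2)[of 0] by auto
  obtain wmin wmax where w: "wmin > 0" "\<And>x. x \<in> {0..1} \<Longrightarrow> wmin \<le> \<psi> x \<and> \<psi> x \<le> wmax"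
    using continuous_positive_bounds[OF psi_cont psi_pos] by blast
  have wmax: "wmax > 0" using w(1) w(2)[of 0] by auto
  obtain \<eta> where \<eta>: "\<eta> > 0" "\<eta> \<le> 1"
    "\<And>g \<delta>. g \<in> hoelder_class \<beta> L {0..1} \<Longrightarrow> 0 < \<delta> \<Longrightarrow> \<delta> \<le> 1 \<Longrightarrow>
     2 * L * \<delta> powr \<beta> \<le> sup_norm_on {0..1} g \<Longrightarrow>
     (\<exists>a s. 0 \<le> a \<and> a + \<eta> * \<delta> \<le> 1 \<and> s \<in> {-1, 1::real} \<and>
        (\<forall>x\<in>{a..a + \<eta> * \<delta>}. s * g x \<ge> sup_norm_on {0..1} g / 2))"
    using hoelder_plateau[OF beta_pos L_pos] by blast
  define A where "A = m * \<eta> / (8 * m')"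
  have A: "A > 0" using m m' \<eta> by (simp add: A_def)
  \<comment> \<open>signal to noise: the statistic is at least \<open>q * (sqrt N * \<tau>)\<close> while \<open>N * \<tau>\<^sup>2 \<ge> A * c\<^sup>2 * ln n\<close>\<close>
  define q where "q = wmin * antidiagonal_const / (8 * wmax)"
  have q: "q > 0" using w(1) wmax antidiagonal_const_pos by (simp add: q_def)
  \<comment> \<open>the second bound makes plateaus available at scale \<open>\<delta>\<close>, the third lifts the statistic above \<open>4 * sqrt (ln n)\<close>\<close>
  define c where "c = max (d_star f \<beta> L) (max (2 * L) (4 / (q * sqrt A)))"
  have c: "c \<ge> d_star f \<beta> L" "c \<ge> 2 * L" "c \<ge> 4 / (q * sqrt A)" "c > 0"
    using L_pos by (auto simp: c_def less_max_iff_disj)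
  define K where "K = 512 * wmax\<^sup>2 / (wmin\<^sup>2 * antidiagonal_const\<^sup>2 * (A * c\<^sup>2))"
  define p where "p = (\<lambda>\<alpha> n l. \<P>(Y in regression_law f (design h n) n l. signed_rank_test f \<psi> (design h n) \<alpha> n Y = 1))"
  define F where "F = (\<lambda>n. {l \<in> weighted_hoelder_class h \<beta> L. sup_norm_on {0..1} (\<lambda>x. l x * sqrt (h x)) \<ge> c * rate \<beta> n})"
  have lower: "1 - K / ln (real n) \<le> p \<alpha> n l"
    if n: "n \<ge> 2" "real n * (m * \<eta> * (ln (real n) / real n) powr (1 / (2 * \<beta> + 1))) \<ge> 3"
      "c * rate \<beta> n / (2 * sqrt m') \<le> 1" "2 / real n \<le> \<alpha>" and l: "l \<in> F n" for n \<alpha> l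
  proof -
    let ?X = "design h n"
    define \<delta> where "\<delta> = (ln (real n) / real n) powr (1 / (2 * \<beta> + 1))"
    have ln: "ln (real n) > 0" "ln (real n) / real n \<le> 1" using n ln_le_minus_one[of "real n"] by auto
    have \<delta>: "\<delta> > 0" "\<delta> \<le> 1" using ln n beta_pos by (auto simp: \<delta>_def powr_le1)
    have rate: "rate \<beta> n = \<delta> powr \<beta>" by (simp add: rate_def \<delta>_def powr_powr)
    \<comment> \<open>\<open>\<delta>\<close> is the scale at which sample size times squared signal equals the squared order of the threshold\<close>
    have n\<delta>: "real n * (\<delta> powr \<beta>)\<^sup>2 * \<delta> = ln (real n)"
    proof -
      have "(\<delta> powr \<beta>)\<^sup>2 * \<delta> = \<delta> powr (2 * \<beta> + 1)"
        using \<delta> by (simp only: powr_add mult_2 powr_one power2_eq_square less_imp_le)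
      also have "\<dots> = ln (real n) / real n" using beta_pos ln n by (simp add: \<delta>_def powr_powr)
      finally have "real n * ((\<delta> powr \<beta>)\<^sup>2 * \<delta>) = ln (real n)" using n by simp
      then show ?thesis by (simp only: mult.assoc)
    qed
    obtain g where g: "g \<in> hoelder_class \<beta> L {0..1}" "l = (\<lambda>x. g x / sqrt (h x))"
      using l by (auto simp: F_def weighted_hoelder_class_def)
    have lg: "sup_norm_on {0..1} (\<lambda>x. l x * sqrt (h x)) = sup_norm_on {0..1} g"
      unfolding sup_norm_on_def g(2) using h_pos by (intro SUP_cong refl) force
    then have sup: "sup_norm_on {0..1} g \<ge> c * rate \<beta> n" using l by (simp add: F_def)
    have "2 * L * \<delta> powr \<beta> \<le> c * rate \<beta> n" using c(2) by (simp add: rate mult_right_mono)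
    then obtain a s where a: "0 \<le> a" "a + \<eta> * \<delta> \<le> 1" "s \<in> {-1, 1::real}"
      "\<forall>x\<in>{a..a + \<eta> * \<delta>}. s * g x \<ge> sup_norm_on {0..1} g / 2"
      using \<eta>(3)[OF g(1) \<delta>] sup by fastforce
    define \<tau> where "\<tau> = c * rate \<beta> n / (2 * sqrt m')"
    have \<tau>: "0 < \<tau>" "\<tau> \<le> 1" using n c m' \<delta> by (auto simp: \<tau>_def rate)
    have sl: "s * l x \<ge> \<tau>" if x: "x \<in> {a..a + \<eta> * \<delta>}" for x
    proof -
      have x01: "x \<in> {0..1}" using x a by auto
      have hx: "0 < sqrt (h x)" "sqrt (h x) \<le> sqrt m'" using h_pos[OF x01] m(2)[OF x01] by auto
      have gx: "s * g x \<ge> c * rate \<beta> n / 2" using a(4) x sup by force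
      have "\<tau> = (c * rate \<beta> n / 2) / sqrt m'" by (simp add: \<tau>_def)
      also have "\<dots> \<le> (c * rate \<beta> n / 2) / sqrt (h x)"
        using hx c(4) by (intro divide_left_mono) (auto simp: rate)
      also have "\<dots> \<le> (s * g x) / sqrt (h x)" using gx hx by (intro divide_right_mono) auto
      finally show ?thesis by (simp add: g(2))
    qed
    obtain j k where jk: "1 \<le> j" "k \<le> n" "\<forall>i\<in>{j..k}. ?X i \<in> {a..a + \<eta> * \<delta>}"
      "real k - real j \<ge> real n * m * (\<eta> * \<delta>) - 2"
      using many_design_points[of a "a + \<eta> * \<delta>" n] a n \<eta> \<delta> by auto
    have n3: "real n * m * (\<eta> * \<delta>) \<ge> 3" using n(2) by (simp add: \<delta>_def mult.assoc)
    have jk': "j < k" using jk(4) n3 by linarith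
    define N where "N = real (Suc k - j)"
    have N: "N \<ge> real n * m * (\<eta> * \<delta>) / 2" using jk(4) n3 jk' by (simp add: N_def)
    have N\<tau>: "N * \<tau>\<^sup>2 \<ge> A * c\<^sup>2 * ln (real n)"
    proof -
      have "A * c\<^sup>2 * ln (real n) = real n * m * (\<eta> * \<delta>) / 2 * \<tau>\<^sup>2"
        unfolding n\<delta>[symmetric] A_def \<tau>_def rate using m' by (simp add: power_divide power_mult_distrib)
      also have "\<dots> \<le> N * \<tau>\<^sup>2" using N by (intro mult_right_mono) auto
      finally show ?thesis .
    qed
    have "N > 0" using jk' by (simp add: N_def)
    have kernel: "wmin \<le> rescaled_kernel \<psi> (?X j) (?X k) (?X i) \<and> rescaled_kernel \<psi> (?X j) (?X k) (?X i) \<le> wmax"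
      if i: "i \<in> {j..k}" for i
    proof -
      have "?X j \<le> ?X i" using design_strict_mono[of j i n] i jk(2) by (cases "j = i") auto
      moreover have "?X i \<le> ?X k" using design_strict_mono[of i k n] i jk(2) by (cases "i = k") auto
      moreover have "?X j < ?X k" using design_strict_mono[of j k n] jk(2) jk' by auto
      ultimately have "(?X i - ?X j) / (?X k - ?X j) \<in> {0..1}" by simp
      then show ?thesis unfolding rescaled_kernel_def by (rule w(2))
    qed
    \<comment> \<open>the union bound over \<open>n\<^sup>2\<close> pairs then gives \<open>2 * n\<^sup>2 * exp (- 3 * ln n) = 2 / n\<close>\<close>
    define C where "C = sqrt (6 * ln (real n))"
    have C: "C > 0" using ln by (simp add: C_def)
    have "2 * (real n)\<^sup>2 * exp (- C\<^sup>2 / 2) = 2 * (real n)\<^sup>2 * exp (- (3 * ln (real n)))"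
      using ln by (simp add: C_def)
    also have "\<dots> = 2 * (real n)\<^sup>2 / (real n) ^ 3"
      using n by (simp add: exp_minus exp_of_nat_mult[of 3 "ln (real n)", simplified] field_simps)
    also have "\<dots> = 2 / real n" using n by (simp add: power2_eq_square power3_eq_cube)
    finally have C2: "2 * (real n)\<^sup>2 * exp (- C\<^sup>2 / 2) \<le> \<alpha>" using n(4) by simp
    have big: "C + sqrt (2 * ln (real n)) \<le> q * (sqrt N * \<tau>)"
    proof -
      have "sqrt 6 \<le> (5/2::real)" by (rule real_le_lsqrt) (simp_all add: power2_eq_square)
      moreover have "sqrt 2 \<le> (3/2::real)" by (rule real_le_lsqrt) (simp_all add: power2_eq_square)
      ultimately have "(sqrt 6 + sqrt 2) * sqrt (ln (real n)) \<le> 4 * sqrt (ln (real n))"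
        using ln by (intro mult_right_mono) auto
      then have "C + sqrt (2 * ln (real n)) \<le> 4 * sqrt (ln (real n))"
        by (simp add: C_def real_sqrt_mult distrib_right)
      also have "\<dots> = q * (4 / (q * sqrt A)) * sqrt (A * ln (real n))"
        using q A by (simp add: real_sqrt_mult)
      also have "\<dots> \<le> q * c * sqrt (A * ln (real n))"
        using c(3) q A ln by (intro mult_right_mono mult_left_mono) auto
      also have "\<dots> = q * sqrt (A * c\<^sup>2 * ln (real n))" using c(4) by (simp add: real_sqrt_mult)
      also have "\<dots> \<le> q * sqrt (N * \<tau>\<^sup>2)" using N\<tau> q by (intro mult_left_mono) auto
      also have "\<dots> = q * (sqrt N * \<tau>)" using \<tau> by (simp add: real_sqrt_mult)
      finally show ?thesis .
    qed
    have "1 - 512 * wmax\<^sup>2 / (wmin\<^sup>2 * antidiagonal_const\<^sup>2 * (N * \<tau>\<^sup>2)) \<le> p \<alpha> n l"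
      unfolding p_def N_def
      by (rule rejection_probability[OF n(1) jk(1) jk' jk(2) w(1) kernel a(3) \<tau> _ C C2 big[unfolded q_def N_def]])
         (use sl jk(3) in auto)
    moreover have "512 * wmax\<^sup>2 / (wmin\<^sup>2 * antidiagonal_const\<^sup>2 * (N * \<tau>\<^sup>2)) \<le> 512 * wmax\<^sup>2 / (wmin\<^sup>2 * antidiagonal_const\<^sup>2 * (A * c\<^sup>2 * ln (real n)))"
      using N\<tau> w(1) antidiagonal_const_pos A c(4) ln \<open>N > 0\<close> \<tau> by (intro divide_left_mono mult_left_mono) auto
    moreover have "\<dots> = K / ln (real n)" by (simp add: K_def)
    ultimately show ?thesis by linarith
  qed
  have nonempty: "F n \<noteq> {}" for n
  proof -
    let ?l = "\<lambda>x. c * rate \<beta> n / sqrt (h x)"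
    \<comment> \<open>constants belong to the class, so the infimum over the alternatives is not the infimum of an empty set\<close>
    define k where "k = nat (\<lceil>\<beta>\<rceil> - 1)"
    have k: "real k < \<beta>" "\<beta> \<le> real k + 1" using beta_pos unfolding k_def by linarith+
    define D where "D = (\<lambda>j (x::real). if j = (0::nat) then c * rate \<beta> n else 0)"
    have "(\<lambda>x. c * rate \<beta> n) \<in> hoelder_class \<beta> L {0..1}"
      unfolding hoelder_class_def
      by (rule CollectI, rule exI[of _ k], rule exI[of _ D]) (use k L_pos in \<open>auto simp: D_def\<close>)
    then have "?l \<in> weighted_hoelder_class h \<beta> L" unfolding weighted_hoelder_class_def by (rule image_eqI[rotated]) simp
    moreover have "sup_norm_on {0..1} (\<lambda>x. ?l x * sqrt (h x)) = sup_norm_on {0..1} (\<lambda>x. c * rate \<beta> n)"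
      unfolding sup_norm_on_def using h_pos by (intro SUP_cong refl) force
    moreover have "\<dots> = \<bar>c * rate \<beta> n\<bar>" by (simp add: sup_norm_on_def)
    ultimately have "?l \<in> F n" by (simp add: F_def)
    then show ?thesis by blast
  qed
  have "liminf (\<lambda>n. INF l\<in>F n. ereal (p \<alpha> n l)) = 1" if \<alpha>: "\<alpha> \<in> {0<..<1}" for \<alpha>
  proof (rule antisym)
    have "(INF l\<in>F n. ereal (p \<alpha> n l)) \<le> 1" for n
    proof -
      obtain l where "l \<in> F n" using nonempty by blast
      moreover have "p \<alpha> n l \<le> 1" unfolding p_def
        by (rule prob_space.prob_le_1) (rule regression_law_measure(2)[of n "\<lambda>_. False"], simp)
      ultimately show ?thesis by (intro INF_lower2) auto
    qed
    then have "liminf (\<lambda>n. INF l\<in>F n. ereal (p \<alpha> n l)) \<le> liminf (\<lambda>n. 1)"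
      by (intro Liminf_mono always_eventually) auto
    then show "liminf (\<lambda>n. INF l\<in>F n. ereal (p \<alpha> n l)) \<le> 1" by (simp add: Liminf_const)
  next
    note lim = rate_limits[OF beta_pos]
    have "filterlim (\<lambda>n. (m * \<eta>) * (real n * (ln (real n) / real n) powr (1 / (2 * \<beta> + 1)))) at_top sequentially"
      using m \<eta> lim(1) by (intro filterlim_tendsto_pos_mult_at_top[OF tendsto_const]) auto
    then have "\<forall>\<^sub>F n in sequentially. 3 \<le> (m * \<eta>) * (real n * (ln (real n) / real n) powr (1 / (2 * \<beta> + 1)))"
      by (simp add: filterlim_at_top)
    then have e1: "\<forall>\<^sub>F n in sequentially. real n * (m * \<eta> * (ln (real n) / real n) powr (1 / (2 * \<beta> + 1))) \<ge> 3"
      by (simp add: mult_ac)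
    have "(\<lambda>n. c * rate \<beta> n / (2 * sqrt m')) \<longlonglongrightarrow> c * 0 / (2 * sqrt m')"
      using m' lim(2) by (intro tendsto_intros) auto
    then have e2: "\<forall>\<^sub>F n in sequentially. c * rate \<beta> n / (2 * sqrt m') \<le> 1"
      using order_tendstoD(2)[of "\<lambda>n. c * rate \<beta> n / (2 * sqrt m')" 0 sequentially 1]
      by (auto elim: eventually_mono)
    have "(\<lambda>n. 2 / real n) \<longlonglongrightarrow> 0" by real_asymp
    then have e3: "\<forall>\<^sub>F n in sequentially. 2 / real n \<le> \<alpha>"
      using order_tendstoD(2)[of "\<lambda>n. 2 / real n" 0 sequentially \<alpha>] \<alpha> by (auto elim: eventually_mono)
    have "\<forall>\<^sub>F n in sequentially. ereal (1 - K / ln (real n)) \<le> (INF l\<in>F n. ereal (p \<alpha> n l))"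
      using e1 e2 e3 eventually_ge_at_top[of 2]
    proof eventually_elim
      case (elim n)
      show ?case by (intro INF_greatest) (use lower[OF elim(4,1,2,3)] in simp)
    qed
    then have "liminf (\<lambda>n. ereal (1 - K / ln (real n))) \<le> liminf (\<lambda>n. INF l\<in>F n. ereal (p \<alpha> n l))"
      by (rule Liminf_mono)
    moreover have "(\<lambda>n. 1 - K / ln (real n)) \<longlonglongrightarrow> 1" by real_asymp
    then have "(\<lambda>n. ereal (1 - K / ln (real n))) \<longlonglongrightarrow> 1" by (simp add: one_ereal_def)
    then have "liminf (\<lambda>n. ereal (1 - K / ln (real n))) = 1" by (intro lim_imp_Liminf) auto
    ultimately show "1 \<le> liminf (\<lambda>n. INF l\<in>F n. ereal (p \<alpha> n l))" by simp
  qed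
  then show ?thesis unfolding p_def F_def using c(1) by blast
qed

end
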